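(* Let $S=\{n\in\mathbb{Z}_{>0} : n=\|\gamma\|^{2}\text{ for some }\gamma\in\mathrm{SL}(2,\mathbb{Z}[i])\}$. Then $S$ contains every odd integer $n\ge 3$. In particular, $S$ contains every prime number.
   Context: $\mathbb{Z}[i]$ denotes the Gaussian integers and $\mathrm{SL}(2,\mathbb{Z}[i])$ the group of $2\times 2$ matrices with entries in $\mathbb{Z}[i]$ and determinant $1$. For $\gamma=\begin{pmatrix}a&b\\c&d\end{pmatrix}$ with complex entries, the norm-square is $\|\gamma\|^{2}=|a|^{2}+|b|^{2}+|c|^{2}+|d|^{2}$, i.e. the sum of the squares of the real and imaginary parts of all four entries. *)

theory Defs
  imports "HOL-Analysis.Analysis" "HOL-Computational_Algebra.Primes"
begin

definition gaussian_int :: "complex \<Rightarrow> bool" where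
  "gaussian_int z \<longleftrightarrow> Re z \<in> \<int> \<and> Im z \<in> \<int>"

definition SL2_Zi :: "(complex^2^2) set" where
  "SL2_Zi = {A. (\<forall>i j. gaussian_int (A $ i $ j)) \<and> det A = 1}"

definition normsq :: "complex^2^2 \<Rightarrow> real" where
  "normsq A = (\<Sum>i\<in>UNIV. \<Sum>j\<in>UNIV. (cmod (A $ i $ j))^2)"

definition S_set :: "int set" where
  "S_set = {n. n > 0 \<and> (\<exists>\<gamma>\<in>SL2_Zi. real_of_int n = normsq \<gamma>)}"

end

theory Submission
  imports Defs "HOL-Number_Theory.Number_Theory" "HOL-Computational_Algebra.Squarefree"
    "HOL-Library.Discrete_Functions"
begin

text \<open>
  For \<open>\<gamma>\<close> in \<open>SL(2, \<int>[i])\<close> the Hermitian matrix \<open>\<gamma> \<gamma>\<^sup>*\<close> has determinant 1 and trace \<open>\<parallel>\<gamma>\<parallel>\<^sup>2\<close>; conversely, by reduction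
  every positive definite Hermitian matrix over \<open>\<int>[i]\<close> of determinant 1 has this shape. Hence \<open>n\<close> is attained iff
  \<open>n = p + r\<close> with \<open>p r = 1 + x\<^sup>2 + y\<^sup>2\<close>, and for odd \<open>n\<close> this says that \<open>n\<^sup>2 - 4 = (p - r)\<^sup>2 + (2 x)\<^sup>2 + (2 y)\<^sup>2\<close> is a
  sum of three squares.

  Let \<open>m\<close> be squarefree with \<open>m \<equiv> 1 (mod 4)\<close>. If \<open>q \<equiv> 1 (mod 4)\<close> is prime and \<open>-q\<close> is a square modulo every prime
  divisor of \<open>m\<close>, then \<open>m\<close> is a square modulo \<open>q\<close> by reciprocity, a pigeonhole argument solves
  \<open>m y\<^sup>2 = x\<^sup>2 + q z\<^sup>2\<close>, and as \<open>q\<close> is a sum of two squares, \<open>m\<close> is a sum of three rational, hence integral, squares.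
  The prime \<open>q\<close> is prescribed by values of real characters only, so a weak form of Dirichlet's theorem
  suffices, which follows from the boundedness of \<open>\<Sum>d\<le>N. \<psi>(d) \<Lambda>(d) / d\<close>, that is, from \<open>L(1, \<psi>) \<noteq> 0\<close> for real \<open>\<psi>\<close>.
\<close>

section \<open>Chebyshev and Mertens estimates\<close>

text \<open>Abel summation: the nonnegative differences \<open>f k - f (Suc k)\<close> together with
  the last \<open>f n\<close> telescope to \<open>f 0\<close>, so bounded partial sums of
  \<open>c\<close> cost only the factor \<open>B\<close>.\<close>

lemma abs_sum_abel_le:
  fixes c f :: "nat \<Rightarrow> real"
  assumes C: "\<And>n. \<bar>\<Sum>k<n. c k\<bar> \<le> B" and dec: "\<And>k. f (Suc k) \<le> f k" and nn: "\<And>k. 0 \<le> f k"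
  shows "\<bar>\<Sum>k<n. c k * f k\<bar> \<le> B * f 0"
proof -
  let ?C = "\<lambda>n. \<Sum>k<n. c k"
  have "(\<Sum>k<n. c k * f k) = (\<Sum>k<n. ?C (Suc k) * (f k - f (Suc k))) + ?C n * f n"
    by (induction n) (simp_all add: algebra_simps)
  also have "\<bar>\<dots>\<bar> \<le> (\<Sum>k<n. B * (f k - f (Suc k))) + B * f n"
  proof (intro abs_triangle_ineq[THEN order_trans] add_mono)
    show "\<bar>\<Sum>k<n. ?C (Suc k) * (f k - f (Suc k))\<bar> \<le> (\<Sum>k<n. B * (f k - f (Suc k)))"
    proof (intro sum_abs[THEN order_trans] sum_mono)
      fix k
      show "\<bar>?C (Suc k) * (f k - f (Suc k))\<bar> \<le> B * (f k - f (Suc k))"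
        unfolding abs_mult using C[of "Suc k"] dec[of k] by (intro mult_mono) auto
    qed
    show "\<bar>?C n * f n\<bar> \<le> B * f n"
      unfolding abs_mult using C[of n] nn[of n] by (intro mult_mono) auto
  qed
  also have "\<dots> = B * f 0"
    unfolding sum_distrib_left[symmetric] sum_lessThan_telescope' by (simp add: algebra_simps)
  finally show ?thesis .
qed

text \<open>Counts pairs by \<open>n = d * k\<close>. The shape \<open>F d (n div d)\<close> covers
  Chebyshev's identity, the Lambert series and the convolution of \<open>\<psi> \<Lambda>\<close>
  with \<open>\<psi>\<close>.\<close>

lemma sum_divisors_swap:
  fixes F :: "nat \<Rightarrow> nat \<Rightarrow> 'a::comm_monoid_add"
  shows "(\<Sum>n=1..N. \<Sum>d | d dvd n. F d (n div d)) = (\<Sum>d=1..N. \<Sum>k=1..N div d. F d k)"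
proof -
  have "(\<Sum>n=1..N. \<Sum>d | d dvd n. F d (n div d)) =
      (\<Sum>(n, d)\<in>Sigma {1..N} (\<lambda>n. {d. d dvd n}). F d (n div d))"
    by (rule sum.Sigma) auto
  also have "\<dots> = (\<Sum>(d, k)\<in>Sigma {1..N} (\<lambda>d. {1..N div d}). F d k)"
  proof (rule sum.reindex_bij_witness[where i = "\<lambda>(d, k). (d * k, d)" and j = "\<lambda>(n, d). (d, n div d)"])
    fix z assume "z \<in> Sigma {1..N} (\<lambda>n. {d. d dvd n})"
    then obtain n d where z: "z = (n, d)" "1 \<le> n" "n \<le> N" "d dvd n" by auto
    then obtain k where k: "n = d * k" by (elim dvdE)
    with z(2) have "0 < d" "0 < k" by (auto intro: Nat.gr0I)
    moreover have "d \<le> N" using k \<open>0 < k\<close> z(3) le_trans[of d n N] by simp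
    ultimately show "(case z of (n, d) \<Rightarrow> (d, n div d)) \<in> Sigma {1..N} (\<lambda>d. {1..N div d})"
      using z(1,3) k by (auto simp: less_eq_div_iff_mult_less_eq mult.commute)
    show "(case case z of (n, d) \<Rightarrow> (d, n div d) of (d, k) \<Rightarrow> (d * k, d)) = z"
      using z by simp
    show "(case case z of (n, d) \<Rightarrow> (d, n div d) of (d, k) \<Rightarrow> F d k) = (case z of (n, d) \<Rightarrow> F d (n div d))"
      using z by simp
  next
    fix z assume "z \<in> Sigma {1..N} (\<lambda>d. {1..N div d})"
    then obtain d k where z: "z = (d, k)" "1 \<le> d" "d \<le> N" "1 \<le> k" "k \<le> N div d" by auto
    then show "(case z of (d, k) \<Rightarrow> (d * k, d)) \<in> Sigma {1..N} (\<lambda>n. {d. d dvd n})"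
      by (auto simp: less_eq_div_iff_mult_less_eq mult.commute)
    show "(case case z of (d, k) \<Rightarrow> (d * k, d) of (n, d) \<Rightarrow> (d, n div d)) = z"
      using z by simp
  qed
  also have "\<dots> = (\<Sum>d=1..N. \<Sum>k=1..N div d. F d k)"
    by (rule sum.Sigma[symmetric]) auto
  finally show ?thesis .
qed

lemma sum_ln_eq_sum_mangoldt:
  "(\<Sum>n=1..N. ln (real n)) = (\<Sum>d=1..N. mangoldt d * real (N div d))"
proof -
  have "(\<Sum>n=1..N. ln (real n)) = (\<Sum>n=1..N. \<Sum>d | d dvd n. mangoldt d)"
    by (rule sum.cong) (auto simp: mangoldt_sum)
  also have "\<dots> = (\<Sum>d=1..N. \<Sum>k=1..N div d. mangoldt d)"
    by (rule sum_divisors_swap)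
  finally show ?thesis by (simp add: mult.commute)
qed

text \<open>The left side is the logarithm of the central binomial coefficient; each step multiplies
  the coefficient by at most 4, and \<open>2 * ln 2 \<le> 2\<close>.\<close>

lemma sum_ln_double_le: "(\<Sum>n=1..2*N. ln (real n)) - 2 * (\<Sum>n=1..N. ln (real n)) \<le> 2 * real N"
proof (induction N)
  case (Suc N)
  have "ln (real (2 * N + 1)) \<le> ln (2 * (real N + 1))" by (subst ln_le_cancel_iff) auto
  moreover have "ln (2 * (real N + 1)) = ln 2 + ln (real N + 1)" by (rule ln_mult_pos) auto
  moreover have "real (2 * N + 2) = 2 * (real N + 1)" by simp
  moreover have "ln (2::real) \<le> 1" using ln_le_minus_one[of "2::real"] by simp
  moreover have "(\<Sum>n=1..2 * Suc N. ln (real n)) =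
      (\<Sum>n=1..2 * N. ln (real n)) + ln (real (2 * N + 1)) + ln (real (2 * N + 2))"
    by (simp add: add.commute)
  moreover have "(\<Sum>n=1..Suc N. ln (real n)) = (\<Sum>n=1..N. ln (real n)) + ln (real N + 1)"
    by (simp add: add.commute)
  ultimately show ?case using Suc.IH by (simp only: of_nat_Suc algebra_simps)
qed simp

text \<open>In the logarithm of the central binomial coefficient \<open>mangoldt d\<close> has
  weight \<open>2 * N div d - 2 * (N div d)\<close>, which is 1 for \<open>N < d \<le> 2 * N\<close>
  and never negative.\<close>

lemma chebyshev_psi_double_le: "(\<Sum>d=1..2*N. mangoldt d) \<le> (\<Sum>d=1..N. mangoldt d) + 2 * real N"
proof -
  have "(\<Sum>d=1..2*N. mangoldt d) - (\<Sum>d=1..N. mangoldt d) = (\<Sum>d\<in>{N+1..2*N}. mangoldt d :: real)"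
    using sum.ub_add_nat[of 1 N "mangoldt :: nat \<Rightarrow> real" N] by (simp add: mult_2)
  also have "\<dots> = (\<Sum>d\<in>{N+1..2*N}. mangoldt d * (real (2 * N div d) - 2 * real (N div d)))"
  proof (rule sum.cong)
    fix d assume d: "d \<in> {N+1..2*N}"
    then have "N div d = 0" "2 * N div d = 1" by (auto intro!: div_nat_eqI)
    then show "mangoldt d = mangoldt d * (real (2 * N div d) - 2 * real (N div d))" by simp
  qed simp
  also have "\<dots> \<le> (\<Sum>d=1..2*N. mangoldt d * (real (2 * N div d) - 2 * real (N div d)))"
  proof (rule sum_mono2)
    fix d
    have "N div d * 2 \<le> 2 * N div d"
      by (cases "d = 0") (simp_all add: less_eq_div_iff_mult_less_eq)
    then have "2 * real (N div d) \<le> real (2 * N div d)" by linarith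
    then show "0 \<le> mangoldt d * (real (2 * N div d) - 2 * real (N div d))"
      by (intro mult_nonneg_nonneg) (simp_all add: mangoldt_nonneg)
  qed auto
  also have "\<dots> = (\<Sum>d=1..2*N. mangoldt d * real (2 * N div d)) - 2 * (\<Sum>d=1..2*N. mangoldt d * real (N div d))"
    by (simp add: algebra_simps sum_subtractf sum_distrib_left)
  also have "(\<Sum>d=1..2*N. mangoldt d * real (N div d)) = (\<Sum>d=1..N. mangoldt d * real (N div d))"
    by (rule sum.mono_neutral_right) auto
  also have "(\<Sum>d=1..2*N. mangoldt d * real (2 * N div d)) - 2 * \<dots> \<le> 2 * real N"
    using sum_ln_double_le[of N] unfolding sum_ln_eq_sum_mangoldt .
  finally show ?thesis by simp
qed

lemma chebyshev_psi_le: "(\<Sum>d=1..N. mangoldt d) \<le> 4 * real N"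
proof (induction N rule: less_induct)
  case (less N)
  show ?case
  proof (cases "N = 0")
    case False
    \<comment> \<open>Doubling gives \<open>4 * K + 2 * K\<close>, and an odd \<open>N\<close> adds
      at most \<open>ln N \<le> N - 1 = 2 * K\<close>; the total \<open>8 * K\<close> stays within
      \<open>4 * N\<close>.\<close>
    define K where "K = N div 2"
    have IH: "(\<Sum>d=1..K. mangoldt d) \<le> 4 * real K" using less False unfolding K_def by simp
    show ?thesis
    proof (cases "even N")
      case True
      then have "N = 2 * K" unfolding K_def by simp
      then show ?thesis using chebyshev_psi_double_le[of K] IH by simp
    next
      case odd: False
      then have N: "N = Suc (2 * K)" unfolding K_def by presburger
      have "mangoldt N \<le> ln (real N)" using False mangoldt_le[of N] by simp
      also have "\<dots> \<le> 2 * real K" using ln_le_minus_one[of "real N"] False N by simp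
      finally show ?thesis using chebyshev_psi_double_le[of K] IH unfolding N by simp
    qed
  qed simp
qed

lemma sum_ln_ge: "N \<ge> 1 \<Longrightarrow> real N * ln (real N) - real N \<le> (\<Sum>n=1..N. ln (real n))"
proof (induction N rule: dec_induct)
  case (step N)
  have "ln (real (Suc N)) - ln (real N) = ln (real (Suc N) / real N)"
    using step.hyps by (simp add: ln_div)
  also have "real (Suc N) / real N = 1 + 1 / real N" using step.hyps by (simp add: field_simps)
  also have "ln \<dots> \<le> 1 / real N" using step.hyps by (intro ln_add_one_self_le_self) simp
  finally have "real N * (ln (real (Suc N)) - ln (real N)) \<le> 1"
    using step.hyps by (simp add: field_simps)
  then show ?case using step.IH by (simp add: algebra_simps)
qed simp

text \<open>The lower half of Mertens' estimate: weaken \<open>N div d\<close> to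
  \<open>N / d\<close> in Chebyshev's identity and compare with Stirling's lower bound.\<close>

lemma sum_mangoldt_over_ge:
  assumes "N \<ge> 1"
  shows "ln (real N) - 1 \<le> (\<Sum>d=1..N. mangoldt d / real d)"
proof -
  have "real N * (ln (real N) - 1) \<le> (\<Sum>d=1..N. mangoldt d * real (N div d))"
    using sum_ln_ge[OF assms] unfolding sum_ln_eq_sum_mangoldt by (simp add: algebra_simps)
  also have "\<dots> \<le> (\<Sum>d=1..N. real N * (mangoldt d / real d))"
  proof (rule sum_mono)
    fix d
    have "mangoldt d * real (N div d) \<le> mangoldt d * (real N / real d)"
      by (intro mult_left_mono of_nat_div_le_of_nat mangoldt_nonneg)
    then show "mangoldt d * real (N div d) \<le> real N * (mangoldt d / real d)" by (simp add: mult.commute)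
  qed
  finally have "real N * (ln (real N) - 1) \<le> real N * (\<Sum>d=1..N. mangoldt d / real d)"
    unfolding sum_distrib_left .
  then show ?thesis using assms by simp
qed

section \<open>Monotonicity of the Lambert series weights\<close>

text \<open>Pair the exponents \<open>j\<close> and \<open>d - j\<close>: the geometric mean of the
  two terms is always \<open>u ^ d\<close>.\<close>

lemma sum_geometric_AM_GM:
  fixes u :: real
  assumes "0 \<le> u"
  shows "real (Suc d) * u ^ d \<le> (\<Sum>j<Suc d. (u\<^sup>2) ^ j)"
proof -
  have "2 * (real (Suc d) * u ^ d) = (\<Sum>j<Suc d. 2 * u ^ d)" by simp
  also have "\<dots> \<le> (\<Sum>j<Suc d. (u\<^sup>2) ^ j + (u\<^sup>2) ^ (d - j))"
  proof (rule sum_mono)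
    fix j assume "j \<in> {..<Suc d}"
    then have "u ^ d = u ^ j * u ^ (d - j)" by (simp flip: power_add)
    then show "2 * u ^ d \<le> (u\<^sup>2) ^ j + (u\<^sup>2) ^ (d - j)"
      using sum_squares_bound[of "u ^ j" "u ^ (d - j)"]
      by (simp add: power_mult[symmetric] mult.commute mult.left_commute)
  qed
  also have "\<dots> = 2 * (\<Sum>j<Suc d. (u\<^sup>2) ^ j)"
    using sum.nat_diff_reindex[of "\<lambda>j. (u\<^sup>2) ^ j" "Suc d"] by (simp add: sum.distrib)
  finally show ?thesis by simp
qed

lemma sum_power_1_upto:
  fixes r :: real
  assumes "r \<noteq> 1"
  shows "(\<Sum>k=1..K. r ^ k) = r / (1 - r) - r ^ Suc K / (1 - r)"
proof -
  have "(1 - r) * (\<Sum>k=1..K. r ^ k) = r - r ^ Suc K"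
  proof (induction K)
    case (Suc K)
    have "(1 - r) * (\<Sum>k=1..Suc K. r ^ k) = (1 - r) * (\<Sum>k=1..K. r ^ k) + (1 - r) * r ^ Suc K"
      by (simp add: distrib_left)
    also have "\<dots> = r - r ^ Suc (Suc K)" unfolding Suc.IH by (simp add: algebra_simps)
    finally show ?case .
  qed simp
  then show ?thesis using assms by (simp add: nonzero_eq_divide_eq mult.commute flip: diff_divide_distrib)
qed

text \<open>Monsky's proof of \<open>L(1, \<psi>) \<noteq> 0\<close>: the Lambert series of \<open>\<psi>\<close> differs from \<open>L(1, \<psi>) / (1 - t)\<close> by a sum of
  \<open>\<psi>\<close> against these weights, which decrease in \<open>d\<close> and are therefore harmless by partial summation.
  The square root \<open>u\<close> of \<open>t\<close> below serves only the AM-GM inequality.\<close>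
definition monsky_weight :: "real \<Rightarrow> nat \<Rightarrow> real" where
  "monsky_weight t d = 1 / (real d * (1 - t)) - t ^ d / (1 - t ^ d)"

text \<open>Cancelling \<open>1 - t\<close> from \<open>1 - t ^ d\<close> reduces monotonicity to
  \<open>(d + 1) * (d + 2) * t ^ (d + 1) \<le> S (d + 1) * S (d + 2)\<close> for the geometric sums
  \<open>S\<close>. This is the product of two AM-GM bounds, since
  \<open>t ^ (d + 1) = u ^ (2 * d + 2) \<le> u ^ (2 * d + 1)\<close>.\<close>

lemma
  fixes u :: real
  assumes u: "0 < u" "u < 1"
  shows monsky_weight_Suc_le: "monsky_weight (u\<^sup>2) (Suc (Suc d)) \<le> monsky_weight (u\<^sup>2) (Suc d)"
    and monsky_weight_nonneg: "0 \<le> monsky_weight (u\<^sup>2) (Suc d)"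
    and monsky_weight_1: "monsky_weight (u\<^sup>2) (Suc 0) = 1"
proof -
  define t where "t = u\<^sup>2"
  define S where "S d = (\<Sum>j<d. t ^ j)" for d
  have t: "0 < t" "t < 1" using u by (auto simp: t_def power_less_one_iff)
  have geom: "1 - t ^ d = (1 - t) * S d" for d
    unfolding S_def by (rule one_diff_power_eq)
  have weight: "monsky_weight (u\<^sup>2) (Suc d) = (1 / real (Suc d) - t ^ Suc d / S (Suc d)) / (1 - t)" for d
    unfolding monsky_weight_def t_def[symmetric] geom
    by (simp add: diff_divide_distrib mult.commute del: power_Suc of_nat_Suc)
  have "real (Suc d) * t ^ Suc d \<le> S (Suc d)"
    unfolding S_def using sum_mono[of "{..<Suc d}" "\<lambda>_. t ^ Suc d" "\<lambda>j. t ^ j"] t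
    by (auto simp del: power_Suc sum.lessThan_Suc intro: power_decreasing)
  moreover have Spos: "0 < S (Suc d)" for d unfolding S_def using t by (intro sum_pos) auto
  ultimately have "t ^ Suc d / S (Suc d) \<le> 1 / real (Suc d)"
    by (simp add: divide_le_eq le_divide_eq mult.commute del: power_Suc of_nat_Suc)
  then show "0 \<le> monsky_weight (u\<^sup>2) (Suc d)"
    unfolding weight using t(2) by (intro divide_nonneg_nonneg) auto
  show "monsky_weight (u\<^sup>2) (Suc 0) = 1"
    unfolding monsky_weight_def t_def[symmetric] using t(2) by (simp add: field_simps)
  have "(real (Suc d) * u ^ d) * (real (Suc (Suc d)) * u ^ Suc d) \<le> S (Suc d) * S (Suc (Suc d))"
    unfolding S_def t_def using sum_geometric_AM_GM[of u d] sum_geometric_AM_GM[of u "Suc d"] u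
    by (intro mult_mono sum_nonneg) auto
  moreover have "t ^ Suc d \<le> u ^ d * u ^ Suc d"
    unfolding t_def power_mult[symmetric] power_add[symmetric] using u by (intro power_decreasing) auto
  then have "real (Suc d) * real (Suc (Suc d)) * t ^ Suc d \<le>
      real (Suc d) * real (Suc (Suc d)) * (u ^ d * u ^ Suc d)"
    by (intro mult_left_mono) auto
  ultimately have key: "real (Suc d) * real (Suc (Suc d)) * t ^ Suc d \<le> S (Suc d) * S (Suc (Suc d))"
    by (simp only: mult_ac)
  have S2: "S (Suc (Suc d)) = 1 + t * S (Suc d)"
    unfolding S_def by (subst sum.lessThan_Suc_shift) (simp add: sum_distrib_left del: sum.lessThan_Suc)
  have *: "t ^ Suc d / S (Suc d) - t ^ Suc (Suc d) / S (Suc (Suc d)) =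
      t ^ Suc d / (S (Suc d) * S (Suc (Suc d)))"
  proof -
    have "t ^ Suc d / S (Suc d) - t ^ Suc (Suc d) / S (Suc (Suc d)) =
      t ^ Suc d * (S (Suc (Suc d)) - t * S (Suc d)) / (S (Suc d) * S (Suc (Suc d)))"
      using Spos[of d] Spos[of "Suc d"] by (simp add: field_simps)
    then show ?thesis using S2 by simp
  qed
  have **: "1 / real (Suc d) - 1 / real (Suc (Suc d)) = 1 / (real (Suc d) * real (Suc (Suc d)))"
    by (simp add: field_simps)
  have "t ^ Suc d / (S (Suc d) * S (Suc (Suc d))) \<le> 1 / (real (Suc d) * real (Suc (Suc d)))"
    using key Spos[of d] Spos[of "Suc d"] by (simp add: divide_le_eq le_divide_eq mult_ac del: power_Suc of_nat_Suc)
  then have "1 / real (Suc (Suc d)) - t ^ Suc (Suc d) / S (Suc (Suc d)) \<le>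
      1 / real (Suc d) - t ^ Suc d / S (Suc d)" using * ** by linarith
  then show "monsky_weight (u\<^sup>2) (Suc (Suc d)) \<le> monsky_weight (u\<^sup>2) (Suc d)"
    unfolding weight using t(2) by (intro divide_right_mono) auto
qed

section \<open>Real characters\<close>

text \<open>Induction step for multiplicative functions: splitting off the full power of one prime
  leaves a smaller coprime cofactor.\<close>

lemma prime_power_decompose:
  fixes n :: nat
  assumes "n > 1"
  obtains p k m where "prime p" "\<not> p dvd m" "0 < m" "m < n" "n = p ^ k * m"
proof -
  obtain p where p: "prime p" "p dvd n" using prime_factor_nat[of n] assms by auto
  obtain m where m: "n = p ^ multiplicity p n * m" "\<not> p dvd m"
    using multiplicity_decompose'[of n p] assms p(1) not_prime_unit by (metis not_less_zero)
  have "multiplicity p n > 0" using p assms by (simp add: prime_multiplicity_gt_zero_iff)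
  then have "p ^ multiplicity p n > 1" using p(1) prime_gt_1_nat one_less_power by blast
  moreover have "m > 0" using m(1) assms by (auto intro: Nat.gr0I)
  ultimately have "m < n" using m(1) by (metis mult.commute mult_less_cancel2 nat_mult_1)
  then show thesis using that p(1) m \<open>m > 0\<close> by blast
qed

text \<open>A nonprincipal real Dirichlet character; nonprincipality is expressed by
  \<open>sum_period\<close>, the form that partial summation consumes.\<close>

locale real_character =
  fixes \<psi> :: "nat \<Rightarrow> real" and M :: nat
  assumes modulus_pos: "M > 0"
    and mult: "\<psi> (a * b) = \<psi> a * \<psi> b"
    and periodic: "\<psi> (a + M) = \<psi> a"
    and range: "\<psi> a \<in> {-1, 0, 1}"
    and one: "\<psi> 1 = 1"
    and sum_period: "(\<Sum>k<M. \<psi> k) = 0"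
begin

lemma abs_le_1: "\<bar>\<psi> a\<bar> \<le> 1"
  using range[of a] by auto

lemma power: "\<psi> (a ^ k) = \<psi> a ^ k"
  using one by (induction k) (simp_all add: mult)

lemma abs_sum_le: "\<bar>\<Sum>k<n. \<psi> k\<bar> \<le> real M"
proof (induction n rule: less_induct)
  case (less n)
  show ?case
  proof (cases "n < M")
    case True
    have "\<bar>\<Sum>k<n. \<psi> k\<bar> \<le> (\<Sum>k<n. 1)" by (intro sum_abs[THEN order_trans] sum_mono abs_le_1)
    then show ?thesis using True by simp
  next
    case False
    then obtain j where j: "n = M + j" using le_Suc_ex not_less by blast
    have "(\<Sum>k<M+j. \<psi> k) = (\<Sum>k<M. \<psi> k) + (\<Sum>k<j. \<psi> k)" for j
      by (induction j) (simp_all add: periodic add.commute[of M])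
    then show ?thesis using less.IH[of j] modulus_pos j sum_period by simp
  qed
qed

lemma abs_sum_shift_le: "\<bar>\<Sum>k<n. \<psi> (a + k)\<bar> \<le> 2 * real M"
proof -
  have "(\<Sum>k<a+n. \<psi> k) = (\<Sum>k<a. \<psi> k) + (\<Sum>k<n. \<psi> (a + k))"
    by (induction n) simp_all
  then show ?thesis using abs_sum_le[of "a + n"] abs_sum_le[of a] by linarith
qed

lemma abs_sum_weighted_le:
  assumes "\<And>k. k \<ge> a \<Longrightarrow> f (Suc k) \<le> f k" "\<And>k. k \<ge> a \<Longrightarrow> 0 \<le> f k"
  shows "\<bar>\<Sum>k<n. \<psi> (a + k) * f (a + k)\<bar> \<le> 2 * real M * f a"
  using abs_sum_abel_le[of "\<lambda>k. \<psi> (a + k)" "2 * real M" "\<lambda>k. f (a + k)" n] abs_sum_shift_le assms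
  by simp

section \<open>Convergence of \<open>L(1, \<psi>)\<close>\<close>

definition L1 :: real where "L1 = (\<Sum>n. \<psi> (Suc n) / real (Suc n))"

lemma abs_sum_over_le: "\<bar>\<Sum>k<n. \<psi> (Suc (a + k)) / real (Suc (a + k))\<bar> \<le> 2 * real M / real (Suc a)"
  using abs_sum_weighted_le[of "Suc a" "\<lambda>k. 1 / real k" n] by (simp add: frac_le)

text \<open>Convergence is only conditional, so it comes from the Cauchy criterion and the block
  bounds of partial summation.\<close>

lemma summable_L1: "summable (\<lambda>n. \<psi> (Suc n) / real (Suc n))"
  unfolding summable_Cauchy
proof (intro allI impI)
  fix e :: real assume "e > 0"
  obtain N :: nat where N: "2 * real M / e < real N" using reals_Archimedean2 by blast
  have "norm (\<Sum>k=m..<n. \<psi> (Suc k) / real (Suc k)) < e" if "m \<ge> N" for m n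
  proof -
    have "(\<Sum>k=m..<n. \<psi> (Suc k) / real (Suc k)) = (\<Sum>k<n-m. \<psi> (Suc (m + k)) / real (Suc (m + k)))"
      by (rule sum.reindex_bij_witness[of _ "\<lambda>k. m + k" "\<lambda>k. k - m"]) auto
    then have "norm (\<Sum>k=m..<n. \<psi> (Suc k) / real (Suc k)) \<le> 2 * real M / real (Suc m)"
      using abs_sum_over_le[of m "n - m"] by simp
    also have "2 * real M < e * real (Suc m)"
      using N that \<open>e > 0\<close> by (simp add: divide_less_eq mult.commute) (smt (verit) mult_left_mono of_nat_mono)
    then have "2 * real M / real (Suc m) < e" by (simp add: divide_less_eq)
    finally show ?thesis .
  qed
  then show "\<exists>N. \<forall>m\<ge>N. \<forall>n. norm (\<Sum>k=m..<n. \<psi> (Suc k) / real (Suc k)) < e" by blast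
qed

lemma L1_tail_le: "\<bar>(\<Sum>k=1..K. \<psi> k / real k) - L1\<bar> \<le> 2 * real M / real (Suc K)"
proof -
  let ?a = "\<lambda>n. \<psi> (Suc n) / real (Suc n)"
  have "(\<lambda>n. \<Sum>k<n. ?a (k + K)) \<longlonglongrightarrow> (\<Sum>n. ?a (n + K))"
    using summable_L1 summable_ignore_initial_segment summable_LIMSEQ by blast
  then have "(\<lambda>n. \<bar>\<Sum>k<n. ?a (k + K)\<bar>) \<longlonglongrightarrow> \<bar>\<Sum>n. ?a (n + K)\<bar>" by (rule tendsto_rabs)
  then have "\<bar>\<Sum>n. ?a (n + K)\<bar> \<le> 2 * real M / real (Suc K)"
    by (rule LIMSEQ_le_const2) (use abs_sum_over_le[of K] in \<open>auto simp: add.commute\<close>)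
  moreover have "(\<Sum>n. ?a (n + K)) = L1 - (\<Sum>k<K. ?a k)"
    unfolding L1_def by (rule suminf_minus_initial_segment[OF summable_L1])
  moreover have "(\<Sum>k=1..K. \<psi> k / real k) = (\<Sum>k<K. ?a k)"
    by (simp add: sum.atLeast1_atMost_eq)
  ultimately show ?thesis by (simp add: abs_minus_commute)
qed

section \<open>Divisor sums of a real character\<close>

text \<open>These are the local factors of the divisor sum of \<open>\<psi>\<close>: 0 or 1 by
  alternation for value -1, the single term \<open>0 ^ 0 = 1\<close> for value 0, and
  \<open>k + 1\<close> for value 1.\<close>

lemma sum_powers_nonneg: "0 \<le> (\<Sum>i\<le>k. \<psi> a ^ i)"
  and sum_even_powers_ge_1: "even k \<Longrightarrow> 1 \<le> (\<Sum>i\<le>k. \<psi> a ^ i)"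
proof -
  have "(\<Sum>i\<le>k. (-1) ^ i) = (if even k then 1 else 0 :: real)" by (induction k) auto
  moreover have "(\<Sum>i\<le>k. 0 ^ i) = (1 :: real)" by (induction k) auto
  ultimately show "0 \<le> (\<Sum>i\<le>k. \<psi> a ^ i)" "even k \<Longrightarrow> 1 \<le> (\<Sum>i\<le>k. \<psi> a ^ i)"
    using range[of a] by auto
qed

lemma sum_divisors_primepow_mult:
  assumes "prime p" "\<not> p dvd m" "m > 0"
  shows "(\<Sum>d | d dvd p ^ k * m. \<psi> d) = (\<Sum>i\<le>k. \<psi> p ^ i) * (\<Sum>d | d dvd m. \<psi> d)"
proof -
  have "bij_betw (\<lambda>(i, d). p ^ i * d) ({..k} \<times> {d. d dvd m}) {d. d dvd p ^ k * m}"
    unfolding bij_betw_def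
  proof
    show "inj_on (\<lambda>(i, d). p ^ i * d) ({..k} \<times> {d. d dvd m})"
    proof (rule inj_onI, clarify)
      fix i d j e assume "d dvd m" "e dvd m" and eq: "p ^ i * d = p ^ j * e"
      then have "\<not> p dvd d" "\<not> p dvd e" using assms(2) dvd_trans by blast+
      then have "multiplicity p (p ^ i * d) = i" "multiplicity p (p ^ j * e) = j"
        using assms(1) by (auto intro!: multiplicity_eqI simp: mult.commute)
      then have "i = j" using eq by simp
      then show "i = j \<and> d = e" using eq assms(1) prime_gt_0_nat by auto
    qed
    show "(\<lambda>(i, d). p ^ i * d) ` ({..k} \<times> {d. d dvd m}) = {d. d dvd p ^ k * m}"
    proof (intro equalityI subsetI)
      fix e assume "e \<in> {d. d dvd p ^ k * m}"
      then obtain b c where "e = b * c" "b dvd p ^ k" "c dvd m" using division_decomp by blast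
      moreover from this obtain i where "i \<le> k" "b = p ^ i" using assms(1) by (auto simp: divides_primepow_nat)
      ultimately show "e \<in> (\<lambda>(i, d). p ^ i * d) ` ({..k} \<times> {d. d dvd m})" by auto
    qed (auto intro!: mult_dvd_mono le_imp_power_dvd)
  qed
  then have "(\<Sum>d | d dvd p ^ k * m. \<psi> d) = (\<Sum>(i, d)\<in>{..k} \<times> {d. d dvd m}. \<psi> (p ^ i * d))"
    by (subst sum.reindex_bij_betw[symmetric]) (auto simp: case_prod_unfold)
  also have "\<dots> = (\<Sum>i\<le>k. \<psi> p ^ i) * (\<Sum>d | d dvd m. \<psi> d)"
    unfolding sum_product sum.cartesian_product by (simp add: mult power)
  finally show ?thesis .
qed

lemma sum_divisors_nonneg: "n > 0 \<Longrightarrow> 0 \<le> (\<Sum>d | d dvd n. \<psi> d)"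
proof (induction n rule: less_induct)
  case (less n)
  show ?case
  proof (cases "n > 1")
    case True
    then obtain p k m where "prime p" "\<not> p dvd m" "0 < m" "m < n" "n = p ^ k * m"
      by (rule prime_power_decompose)
    then show ?thesis using less.IH[of m]
      by (simp add: sum_divisors_primepow_mult sum_powers_nonneg)
  next
    case False
    then have "n = 1" using less.prems by simp
    then show ?thesis using one by simp
  qed
qed

text \<open>A square has only even exponents, so each local factor is at least 1. The squares thus
  force the Lambert series to grow as its argument tends to 1.\<close>

lemma sum_divisors_square_ge_1: "n > 0 \<Longrightarrow> 1 \<le> (\<Sum>d | d dvd n\<^sup>2. \<psi> d)"
proof (induction n rule: less_induct)
  case (less n)
  show ?case
  proof (cases "n > 1")
    case True
    then obtain p k m where m: "prime p" "\<not> p dvd m" "0 < m" "m < n" "n = p ^ k * m"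
      by (rule prime_power_decompose)
    have "n\<^sup>2 = p ^ (2 * k) * m\<^sup>2" unfolding m(5) by (simp add: power_mult_distrib power_mult[symmetric] mult.commute)
    moreover have "\<not> p dvd m\<^sup>2" using m(1,2) prime_dvd_power by blast
    ultimately have "(\<Sum>d | d dvd n\<^sup>2. \<psi> d) = (\<Sum>i\<le>2*k. \<psi> p ^ i) * (\<Sum>d | d dvd m\<^sup>2. \<psi> d)"
      using sum_divisors_primepow_mult m(1,3) by simp
    moreover have "1 * 1 \<le> (\<Sum>i\<le>2*k. \<psi> p ^ i) * (\<Sum>d | d dvd m\<^sup>2. \<psi> d)"
      using less.IH[of m] m(3,4) sum_even_powers_ge_1[of "2 * k" p] by (intro mult_mono) auto
    ultimately show ?thesis by simp
  next
    case False
    then have "n = 1" using less.prems by simp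
    then show ?thesis using one by simp
  qed
qed

section \<open>Nonvanishing of \<open>L(1, \<psi>)\<close>\<close>

text \<open>With \<open>n = d * k\<close> the sum over \<open>k\<close> is a truncated geometric
  series, whose limit \<open>t ^ d / (1 - t ^ d)\<close> is \<open>1 / (d * (1 - t))\<close> minus
  the Monsky weight. The three terms bound the weights, the partial sum of the L-series and the
  truncation error.\<close>

lemma lambert_sum_le:
  fixes u :: real
  assumes u: "0 < u" "u < 1"
  defines "t \<equiv> u\<^sup>2"
  shows "(\<Sum>n=1..X. (\<Sum>d | d dvd n. \<psi> d) * t ^ n) \<le>
    2 * real M + \<bar>\<Sum>d=1..X. \<psi> d / real d\<bar> / (1 - t) + real X * t ^ X / (1 - t)"
proof -
  have t: "0 < t" "t < 1" using u by (auto simp: t_def power_less_one_iff)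
  have "(\<Sum>n=1..X. (\<Sum>d | d dvd n. \<psi> d) * t ^ n) = (\<Sum>n=1..X. \<Sum>d | d dvd n. \<psi> d * t ^ (d * (n div d)))"
    by (simp add: sum_distrib_right)
  also have "\<dots> = (\<Sum>d=1..X. \<Sum>k=1..X div d. \<psi> d * t ^ (d * k))" by (rule sum_divisors_swap)
  also have "\<dots> = (\<Sum>d=1..X. \<psi> d / real d / (1 - t) - \<psi> d * monsky_weight t d
      - \<psi> d * (t ^ (d * Suc (X div d)) / (1 - t ^ d)))"
  proof (rule sum.cong)
    fix d assume d: "d \<in> {1..X}"
    have "t ^ d \<le> t ^ 1" using t d by (intro power_decreasing) auto
    then have "t ^ d \<noteq> 1" using t by simp
    then have "(\<Sum>k=1..X div d. t ^ (d * k)) = t ^ d / (1 - t ^ d) - t ^ (d * Suc (X div d)) / (1 - t ^ d)"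
      unfolding power_mult by (rule sum_power_1_upto)
    then show "(\<Sum>k=1..X div d. \<psi> d * t ^ (d * k)) =
      \<psi> d / real d / (1 - t) - \<psi> d * monsky_weight t d - \<psi> d * (t ^ (d * Suc (X div d)) / (1 - t ^ d))"
      unfolding sum_distrib_left[symmetric] monsky_weight_def
      by (simp add: right_diff_distrib[of "\<psi> d"])
  qed simp
  also have "\<dots> = (\<Sum>d=1..X. \<psi> d / real d) / (1 - t) - (\<Sum>d=1..X. \<psi> d * monsky_weight t d)
      - (\<Sum>d=1..X. \<psi> d * (t ^ (d * Suc (X div d)) / (1 - t ^ d)))"
    by (simp only: sum_subtractf sum_divide_distrib)
  also have "\<dots> \<le> \<bar>\<Sum>d=1..X. \<psi> d / real d\<bar> / (1 - t) + 2 * real M + real X * t ^ X / (1 - t)"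
  proof -
    have "(\<Sum>d=1..X. \<psi> d / real d) / (1 - t) \<le> \<bar>\<Sum>d=1..X. \<psi> d / real d\<bar> / (1 - t)"
      using t by (intro divide_right_mono) auto
    moreover have "\<bar>\<Sum>d=1..X. \<psi> d * monsky_weight t d\<bar> \<le> 2 * real M"
    proof -
      have dec: "monsky_weight t (Suc k) \<le> monsky_weight t k \<and> 0 \<le> monsky_weight t k" if k: "1 \<le> k" for k
      proof -
        obtain j where "k = Suc j" using k by (cases k) auto
        then show ?thesis unfolding t_def using monsky_weight_Suc_le[OF u] monsky_weight_nonneg[OF u] by auto
      qed
      have "\<bar>\<Sum>k<X. \<psi> (1 + k) * monsky_weight t (1 + k)\<bar> \<le> 2 * real M * monsky_weight t 1"
        using dec by (intro abs_sum_weighted_le) blast+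
      then show ?thesis unfolding sum.atLeast1_atMost_eq
        using monsky_weight_1[OF u] by (simp add: sum.atLeast1_atMost_eq t_def)
    qed
    moreover have "\<bar>\<Sum>d=1..X. \<psi> d * (t ^ (d * Suc (X div d)) / (1 - t ^ d))\<bar> \<le> real X * t ^ X / (1 - t)"
    proof -
      have "\<bar>\<Sum>d=1..X. \<psi> d * (t ^ (d * Suc (X div d)) / (1 - t ^ d))\<bar> \<le> (\<Sum>d=1..X. t ^ X / (1 - t))"
      proof (intro sum_abs[THEN order_trans] sum_mono)
        fix d assume d: "d \<in> {1..X}"
        \<comment> \<open>The first omitted exponent is already beyond \<open>X\<close>, so every
          truncation error is at most \<open>t ^ X / (1 - t)\<close>.\<close>
        have "X \<le> d * Suc (X div d)" using d dividend_less_div_times[of d X] by (simp add: mult.commute)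
        then have "t ^ (d * Suc (X div d)) \<le> t ^ X" using t by (intro power_decreasing) auto
        moreover have "t ^ d \<le> t ^ 1" using t d by (intro power_decreasing) auto
        ultimately have "t ^ (d * Suc (X div d)) / (1 - t ^ d) \<le> t ^ X / (1 - t)"
          using t by (intro frac_le) auto
        moreover have "0 \<le> t ^ (d * Suc (X div d)) / (1 - t ^ d)"
          using t \<open>t ^ d \<le> t ^ 1\<close> by (intro divide_nonneg_nonneg) auto
        ultimately have "\<bar>t ^ (d * Suc (X div d)) / (1 - t ^ d)\<bar> \<le> t ^ X / (1 - t)"
          by (simp only: abs_of_nonneg)
        then have "\<bar>\<psi> d\<bar> * \<bar>t ^ (d * Suc (X div d)) / (1 - t ^ d)\<bar> \<le> 1 * (t ^ X / (1 - t))"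
          by (intro mult_mono abs_le_1) simp_all
        then show "\<bar>\<psi> d * (t ^ (d * Suc (X div d)) / (1 - t ^ d))\<bar> \<le> t ^ X / (1 - t)"
          by (simp only: abs_mult mult_1_left)
      qed
      then show ?thesis by simp
    qed
    ultimately show ?thesis by linarith
  qed
  finally show ?thesis by simp
qed

text \<open>If \<open>L1 = 0\<close>, the Lambert series is bounded by \<open>2 * M\<close>
  uniformly in \<open>t < 1\<close>; its square terms alone exceed any bound as \<open>t\<close>
  tends to 1.\<close>

lemma L1_nonzero: "L1 \<noteq> 0"
proof
  assume L: "L1 = 0"
  have bound: "(\<Sum>k=1..K. (u\<^sup>2) ^ (k\<^sup>2)) \<le> 2 * real M" if u: "0 < u" "u < 1" for u :: real and K
  proof -
    define t where "t = u\<^sup>2"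
    have t: "0 < t" "t < 1" using u by (auto simp: t_def power_less_one_iff)
    \<comment> \<open>With \<open>L1 = 0\<close> the partial sum up to \<open>X\<close> is of order
      \<open>1 / X\<close>, so for fixed \<open>t\<close> both error terms vanish as
      \<open>X\<close> grows.\<close>
    define B where "B X = 2 * real M + 2 * real M / real (Suc X) / (1 - t) + real X * t ^ X / (1 - t)" for X
    have "(\<lambda>X. real X * t ^ X) \<longlonglongrightarrow> 0" using t by (intro powser_times_n_limit_0) auto
    moreover have "(\<lambda>X. 2 * real M / real (Suc X)) \<longlonglongrightarrow> 0"
      by (intro tendsto_divide_0[OF tendsto_const] filterlim_compose[OF filterlim_real_at_infinity_sequentially]) (rule filterlim_Suc)
    ultimately have "B \<longlonglongrightarrow> 2 * real M + 0 / (1 - t) + 0 / (1 - t)"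
      unfolding B_def using t by (intro tendsto_intros) auto
    then have "B \<longlonglongrightarrow> 2 * real M" by simp
    moreover have "(\<Sum>k=1..K. t ^ (k\<^sup>2)) \<le> B X" if X: "X \<ge> K\<^sup>2" for X
    proof -
      have "(\<Sum>k=1..K. t ^ (k\<^sup>2)) \<le> (\<Sum>n=1..X. (\<Sum>d | d dvd n. \<psi> d) * t ^ n)"
      \<comment> \<open>For each \<open>k\<close> only the term \<open>n = k^2\<close> is kept; the
        floor of the square root recovers \<open>k\<close> from it.\<close>
      proof (rule sum_le_included[where i = "\<lambda>k. nat \<lfloor>sqrt (real k)\<rfloor>"])
        show "\<forall>n\<in>{1..X}. 0 \<le> (\<Sum>d | d dvd n. \<psi> d) * t ^ n"
          using t sum_divisors_nonneg by auto
      next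
        show "\<forall>k\<in>{1..K}. \<exists>n\<in>{1..X}. nat \<lfloor>sqrt (real n)\<rfloor> = k \<and> t ^ k\<^sup>2 \<le> (\<Sum>d | d dvd n. \<psi> d) * t ^ n"
        proof
          fix k assume k: "k \<in> {1..K}"
          then have "k\<^sup>2 \<le> K\<^sup>2" by (intro power_mono) auto
          then have "k\<^sup>2 \<le> X" using X by (rule order_trans)
          then have "k\<^sup>2 \<in> {1..X}" using k by auto
          moreover have "1 * t ^ k\<^sup>2 \<le> (\<Sum>d | d dvd k\<^sup>2. \<psi> d) * t ^ k\<^sup>2"
            using k t sum_divisors_square_ge_1[of k] by (intro mult_right_mono) auto
          ultimately show "\<exists>n\<in>{1..X}. nat \<lfloor>sqrt (real n)\<rfloor> = k \<and> t ^ k\<^sup>2 \<le> (\<Sum>d | d dvd n. \<psi> d) * t ^ n"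
            by (intro bexI[of _ "k\<^sup>2"]) simp_all
        qed
      qed auto
      also have "\<dots> \<le> B X"
      proof -
        have "\<bar>\<Sum>d=1..X. \<psi> d / real d\<bar> \<le> 2 * real M / real (Suc X)" using L1_tail_le[of X] L by simp
        then have "\<bar>\<Sum>d=1..X. \<psi> d / real d\<bar> / (1 - t) \<le> 2 * real M / real (Suc X) / (1 - t)"
          using t by (intro divide_right_mono) auto
        then show ?thesis using lambert_sum_le[OF u, of X] unfolding B_def t_def by simp
      qed
      finally show ?thesis .
    qed
    ultimately show ?thesis unfolding t_def[symmetric] by (intro LIMSEQ_le_const) auto
  qed
  have "real K \<le> 2 * real M" for K
  proof -
    \<comment> \<open>The points \<open>n / (n + 1)\<close> with \<open>n \<ge> 1\<close> lie
      strictly between 0 and 1 and tend to 1, where each of the \<open>K\<close> terms becomes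
      1.\<close>
    have "(\<lambda>n. real n / real (Suc n)) \<longlonglongrightarrow> 1" by (rule LIMSEQ_n_over_Suc_n)
    then have "(\<lambda>n. \<Sum>k=1..K. ((real n / real (Suc n))\<^sup>2) ^ (k\<^sup>2)) \<longlonglongrightarrow> (\<Sum>k=1..K. (1\<^sup>2) ^ (k\<^sup>2))"
      by (intro tendsto_intros)
    then have "(\<Sum>k=1..K. (1\<^sup>2) ^ (k\<^sup>2)) \<le> 2 * real M"
      by (rule LIMSEQ_le_const2) (intro exI[of _ 1] allI impI bound, auto)
    then show ?thesis by simp
  qed
  from this[of "2 * M + 1"] show False by simp
qed

section \<open>A Mertens-type bound for real characters\<close>

text \<open>Expanding \<open>ln\<close> into \<open>mangoldt\<close> turns \<open>T N\<close>, the
  bounded sum of \<open>\<psi> n * ln n / n\<close>, into \<open>L1 * S N\<close> plus an error that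
  Chebyshev's bound controls. Division by \<open>L1 \<noteq> 0\<close> bounds
  \<open>S N\<close>.\<close>

lemma sum_mangoldt_bounded: "\<exists>B. \<forall>N. \<bar>\<Sum>d=1..N. \<psi> d * mangoldt d / real d\<bar> \<le> B"
proof -
  define f where "f n = ln (real n) / real n" for n
  define S where "S N = (\<Sum>d=1..N. \<psi> d * mangoldt d / real d)" for N
  define T where "T N = (\<Sum>n=1..N. \<psi> n * f n)" for N
  have f_nonneg: "0 \<le> f n" for n unfolding f_def by (cases "n = 0") auto
  have T_bound: "\<bar>T N\<bar> \<le> f 1 + f 2 + 2 * real M * f 3" for N
  proof -
    have bd: "\<bar>\<psi> n * f n\<bar> \<le> f n" for n
      using abs_le_1[of n] f_nonneg[of n] by (simp add: abs_mult mult_left_le_one_le)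
    \<comment> \<open>\<open>ln x / x\<close> decreases only from \<open>exp 1 < 3\<close> on, so
      the terms at 1 and 2 are treated separately.\<close>
    have dec: "\<bar>\<Sum>k<n. \<psi> (3 + k) * f (3 + k)\<bar> \<le> 2 * real M * f 3" for n
    proof (rule abs_sum_weighted_le)
      fix k :: nat assume "3 \<le> k"
      then show "f (Suc k) \<le> f k" unfolding f_def using exp_le by (intro ln_x_over_x_mono) auto
    qed (rule f_nonneg)
    have nn: "0 \<le> 2 * real M * f 3" using f_nonneg by simp
    consider "N = 0" | "N = 1" | k where "N = Suc (Suc k)" by (metis One_nat_def not0_implies_Suc)
    then show ?thesis
    proof cases
      case 3
      have "T (Suc (Suc k)) = \<psi> 1 * f 1 + \<psi> 2 * f 2 + (\<Sum>k<k. \<psi> (3 + k) * f (3 + k))" for k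
        unfolding T_def by (induction k) (simp_all add: numeral_eq_Suc)
      then show ?thesis using bd[of 1] bd[of 2] dec[of k] 3 by (smt (verit))
    qed (use bd[of 1] f_nonneg[of 1] f_nonneg[of 2] nn in \<open>auto simp: T_def\<close>)
  qed
  have TS: "\<bar>T N - L1 * S N\<bar> \<le> 8 * real M" for N
  proof (cases "N = 0")
    case False
    have "T N = (\<Sum>n=1..N. \<Sum>d | d dvd n. \<psi> (d * (n div d)) * mangoldt d / real (d * (n div d)))"
      unfolding T_def f_def
    proof (rule sum.cong)
      fix n assume n: "n \<in> {1..N}"
      then have "ln (real n) = (\<Sum>d | d dvd n. mangoldt d)" by (simp add: mangoldt_sum)
      then show "\<psi> n * (ln (real n) / real n) =
          (\<Sum>d | d dvd n. \<psi> (d * (n div d)) * mangoldt d / real (d * (n div d)))"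
        by (simp add: sum_distrib_left sum_divide_distrib)
    qed simp
    also have "\<dots> = (\<Sum>d=1..N. \<Sum>k=1..N div d. \<psi> (d * k) * mangoldt d / real (d * k))"
      by (rule sum_divisors_swap)
    also have "\<dots> = (\<Sum>d=1..N. \<psi> d * mangoldt d / real d * (\<Sum>k=1..N div d. \<psi> k / real k))"
      by (simp add: sum_distrib_left mult mult_ac)
    finally have "T N - L1 * S N =
        (\<Sum>d=1..N. \<psi> d * mangoldt d / real d * ((\<Sum>k=1..N div d. \<psi> k / real k) - L1))"
      unfolding S_def by (simp add: algebra_simps sum_subtractf sum_distrib_left)
    also have "\<bar>\<dots>\<bar> \<le> (\<Sum>d=1..N. mangoldt d * (2 * real M / real N))"
    proof (intro sum_abs[THEN order_trans] sum_mono)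
      fix d assume d: "d \<in> {1..N}"
      \<comment> \<open>The tail of the L-series beyond \<open>N div d\<close> is thus at most
        \<open>d * (2 * M / N)\<close>; the factor \<open>d\<close> cancels \<open>1 / d\<close> and
        leaves Chebyshev's sum.\<close>
      have "N < d * Suc (N div d)" using d dividend_less_div_times[of d N] by (simp add: mult.commute)
      then have "real N \<le> real d * real (Suc (N div d))" by (metis less_imp_le of_nat_le_iff of_nat_mult)
      then have "2 * real M / real (Suc (N div d)) \<le> real d * (2 * real M / real N)"
        using False mult_left_mono[of "real N" "real d * real (Suc (N div d))" "2 * real M"]
        by (simp add: divide_le_eq le_divide_eq mult_ac del: of_nat_Suc)
      then have *: "\<bar>(\<Sum>k=1..N div d. \<psi> k / real k) - L1\<bar> \<le> real d * (2 * real M / real N)"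
        using L1_tail_le[of "N div d"] by linarith
      have "\<bar>\<psi> d * mangoldt d / real d * ((\<Sum>k=1..N div d. \<psi> k / real k) - L1)\<bar> =
          \<bar>\<psi> d\<bar> * (mangoldt d / real d) * \<bar>(\<Sum>k=1..N div d. \<psi> k / real k) - L1\<bar>"
        by (simp add: abs_mult)
      also have "\<dots> \<le> 1 * (mangoldt d / real d) * (real d * (2 * real M / real N))"
        by (intro mult_mono abs_le_1 * mult_nonneg_nonneg divide_nonneg_nonneg mangoldt_nonneg) auto
      also have "\<dots> = mangoldt d * (2 * real M / real N)" using d by simp
      finally show "\<bar>\<psi> d * mangoldt d / real d * ((\<Sum>k=1..N div d. \<psi> k / real k) - L1)\<bar> \<le>
          mangoldt d * (2 * real M / real N)" .
    qed
    also have "\<dots> = (\<Sum>d=1..N. mangoldt d) * (2 * real M / real N)" by (rule sum_distrib_right[symmetric])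
    also have "\<dots> \<le> 4 * real N * (2 * real M / real N)"
      by (intro mult_right_mono chebyshev_psi_le) auto
    finally show ?thesis using False by simp
  qed (simp add: T_def S_def)
  have "\<bar>S N\<bar> \<le> (f 1 + f 2 + 2 * real M * f 3 + 8 * real M) / \<bar>L1\<bar>" for N
  proof -
    have "\<bar>L1 * S N\<bar> \<le> f 1 + f 2 + 2 * real M * f 3 + 8 * real M" using T_bound[of N] TS[of N] by linarith
    then show ?thesis using L1_nonzero by (simp add: le_divide_eq abs_mult mult.commute)
  qed
  then show ?thesis unfolding S_def by blast
qed

end

section \<open>Prime powers with prescribed character values\<close>

text \<open>Multiplication by \<open>a\<close> permutes the residues modulo \<open>M\<close> and
  changes every sign, so the sum over a period equals its own negative.\<close>

lemma real_characterI:
  fixes \<psi> :: "nat \<Rightarrow> real"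
  assumes "M > 0" "\<And>a b. \<psi> (a * b) = \<psi> a * \<psi> b" and per: "\<And>a. \<psi> (a + M) = \<psi> a"
    and "\<And>a. \<psi> a \<in> {-1, 0, 1}" "\<psi> 1 = 1" and a: "coprime a M" "\<psi> a = -1"
  shows "real_character \<psi> M"
proof
  have per_mult: "\<psi> (k + M * j) = \<psi> k" for k j
    by (induction j) (simp_all add: per add.assoc[symmetric] add.commute[of M])
  have mod: "\<psi> (k mod M) = \<psi> k" for k
    using per_mult[of "k mod M" "k div M"] by simp
  have inj: "inj_on (\<lambda>k. a * k mod M) {..<M}"
  proof (rule inj_onI)
    fix k l assume "k \<in> {..<M}" "l \<in> {..<M}" "a * k mod M = a * l mod M"
    then have "[k = l] (mod M)" using cong_mult_lcancel_nat[OF a(1)] by (simp add: Cong.cong_def)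
    then show "k = l" using \<open>k \<in> {..<M}\<close> \<open>l \<in> {..<M}\<close> by (simp add: Cong.cong_def)
  qed
  have "(\<lambda>k. a * k mod M) ` {..<M} = {..<M}"
    using assms(1) by (intro endo_inj_surj inj) auto
  then have "(\<Sum>k<M. \<psi> k) = (\<Sum>k<M. \<psi> (a * k mod M))"
    using sum.reindex[OF inj, of \<psi>] by (simp add: comp_def)
  also have "\<dots> = - (\<Sum>k<M. \<psi> k)" by (simp add: mod assms(2) a(2) sum_negf)
  finally show "(\<Sum>k<M. \<psi> k) = 0" by simp
qed (use assms in auto)

text \<open>Only powers of primes dividing \<open>M\<close> contribute, and for each such prime the
  series is dominated by \<open>ln p\<close> times a geometric series of ratio 1/2.\<close>

lemma sum_mangoldt_not_coprime_le:
  assumes "M > (0::nat)"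
  shows "(\<Sum>d | d \<in> {1..N} \<and> \<not> coprime d M. mangoldt d / real d) \<le> (\<Sum>p\<in>prime_factors M. ln (real p))"
proof -
  have "(\<Sum>d | d \<in> {1..N} \<and> \<not> coprime d M \<and> primepow d. mangoldt d / real d)
      \<le> (\<Sum>(p, k)\<in>prime_factors M \<times> {..<N}. ln (real p) / real p ^ Suc k)"
  proof (rule sum_le_included[where i = "\<lambda>(p, k). p ^ Suc k"])
    show "\<forall>x\<in>prime_factors M \<times> {..<N}. 0 \<le> (case x of (p, k) \<Rightarrow> ln (real p) / real p ^ Suc k)"
      using prime_ge_1_nat by (force simp: in_prime_factors_iff)
  next
    show "\<forall>d\<in>{d. d \<in> {1..N} \<and> \<not> coprime d M \<and> primepow d}. \<exists>x\<in>prime_factors M \<times> {..<N}.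
      (case x of (p, k) \<Rightarrow> p ^ Suc k) = d \<and> mangoldt d / real d \<le> (case x of (p, k) \<Rightarrow> ln (real p) / real p ^ Suc k)"
    proof
      fix d assume d: "d \<in> {d. d \<in> {1..N} \<and> \<not> coprime d M \<and> primepow d}"
      then obtain p k where p: "prime p" "k > 0" "d = p ^ k" unfolding primepow_def by auto
      have "p dvd M"
        using d p prime_imp_coprime[of p M] by auto
      obtain j where j: "k = Suc j" using p(2) by (cases k) auto
      have "j < p ^ k" using p(1) j power_gt_expt[of p k] prime_gt_1_nat by fastforce
      then have "j < N" using d p(3) by auto
      then show "\<exists>x\<in>prime_factors M \<times> {..<N}. (case x of (p, k) \<Rightarrow> p ^ Suc k) = d \<and>
          mangoldt d / real d \<le> (case x of (p, k) \<Rightarrow> ln (real p) / real p ^ Suc k)"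
        using p(1,3) j \<open>p dvd M\<close> assms mangoldt_primepow'[OF p(1), of "Suc j", where ?'a = real]
        by (intro bexI[of _ "(p, j)"]) (auto simp: in_prime_factors_iff simp del: power_Suc)
    qed
  qed auto
  also have "\<dots> = (\<Sum>p\<in>prime_factors M. \<Sum>k<N. ln (real p) / real p ^ Suc k)"
    by (rule sum.cartesian_product[symmetric])
  also have "\<dots> \<le> (\<Sum>p\<in>prime_factors M. ln (real p))"
  proof (rule sum_mono)
    fix p assume "p \<in> prime_factors M"
    then have "2 \<le> p" using prime_ge_2_nat by (auto simp: in_prime_factors_iff)
    have "(\<Sum>k<N. ln (real p) / real p ^ Suc k) \<le> (\<Sum>k<N. ln (real p) / 2 ^ Suc k)"
      using \<open>2 \<le> p\<close> by (intro sum_mono divide_left_mono power_mono mult_pos_pos) auto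
    also have "\<dots> = ln (real p) * (1 - 1 / 2 ^ N)"
      by (induction N) (simp_all add: field_simps)
    also have "\<dots> \<le> ln (real p) * 1"
      using \<open>2 \<le> p\<close> by (intro mult_left_mono) auto
    finally show "(\<Sum>k<N. ln (real p) / real p ^ Suc k) \<le> ln (real p)" by simp
  qed
  finally have "(\<Sum>d | d \<in> {1..N} \<and> \<not> coprime d M \<and> primepow d. mangoldt d / real d) \<le>
    (\<Sum>p\<in>prime_factors M. ln (real p))" .
  moreover have "(\<Sum>d | d \<in> {1..N} \<and> \<not> coprime d M. mangoldt d / real d) =
      (\<Sum>d | d \<in> {1..N} \<and> \<not> coprime d M \<and> primepow d. mangoldt d / real d)"
    by (rule sum.mono_neutral_right) (auto simp: mangoldt_def)
  ultimately show ?thesis by simp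
qed

text \<open>Weight \<open>mangoldt d / d\<close> by the product of the factors
  \<open>1 + s i * c i d\<close> and expand over subsets of \<open>I\<close>. The empty set gives
  \<open>ln N\<close>; every other set gives a nonprincipal character, by \<open>indep\<close>,
  hence a bounded sum. Were no prime power suitable, the whole sum would be bounded.\<close>

theorem exists_primepow_with_signs:
  fixes c :: "'i \<Rightarrow> nat \<Rightarrow> real" and s :: "'i \<Rightarrow> real"
  assumes fin: "finite I" and M: "M > 0"
    and mult: "\<And>i a b. i \<in> I \<Longrightarrow> c i (a * b) = c i a * c i b"
    and per: "\<And>i a. i \<in> I \<Longrightarrow> c i (a + M) = c i a"
    and range: "\<And>i a. i \<in> I \<Longrightarrow> c i a \<in> {-1, 0, 1}"
    and one: "\<And>i. i \<in> I \<Longrightarrow> c i 1 = 1"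
    and nonzero: "\<And>i a. i \<in> I \<Longrightarrow> coprime a M \<Longrightarrow> c i a \<noteq> 0"
    and indep: "\<And>i. i \<in> I \<Longrightarrow> \<exists>a. coprime a M \<and> c i a = -1 \<and> (\<forall>j\<in>I - {i}. c j a = 1)"
    and s: "\<And>i. i \<in> I \<Longrightarrow> s i \<in> {-1, 1}"
  shows "\<exists>d. primepow d \<and> (\<forall>i\<in>I. c i d = s i)"
proof (rule ccontr)
  assume none: "\<nexists>d. primepow d \<and> (\<forall>i\<in>I. c i d = s i)"
  define W where "W d = (\<Prod>i\<in>I. s i * c i d + 1)" for d
  have "\<exists>B. \<forall>N. \<bar>\<Sum>d=1..N. (\<Prod>i\<in>T. c i d) * mangoldt d / real d\<bar> \<le> B" if T: "T \<in> Pow I - {{}}" for T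
  proof -
    have TI: "T \<subseteq> I" and finT: "finite T" using T fin finite_subset by auto
    obtain i where i: "i \<in> T" using T by blast
    then obtain a where a: "coprime a M" "c i a = -1" "\<forall>j\<in>I - {i}. c j a = 1" using indep TI by blast
    have "(\<Prod>j\<in>T. c j a) = c i a * (\<Prod>j\<in>T-{i}. c j a)" using finT i by (rule prod.remove)
    also have "(\<Prod>j\<in>T-{i}. c j a) = 1" using a(3) TI by (intro prod.neutral) auto
    finally have "(\<Prod>j\<in>T. c j a) = -1" using a(2) by simp
    moreover have "(\<Prod>j\<in>T. c j b) \<in> {-1, 0, 1}" for b
      using finT TI by (induction T rule: finite_induct) (use range[of _ b] in fastforce)+
    moreover have "(\<Prod>j\<in>T. c j (x * y)) = (\<Prod>j\<in>T. c j x) * (\<Prod>j\<in>T. c j y)" for x y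
      unfolding prod.distrib[symmetric] using TI mult by (intro prod.cong) auto
    moreover have "(\<Prod>j\<in>T. c j (x + M)) = (\<Prod>j\<in>T. c j x)" for x
      using TI per by (intro prod.cong) auto
    moreover have "(\<Prod>j\<in>T. c j 1) = 1" using TI one by (intro prod.neutral) auto
    ultimately interpret real_character "\<lambda>b. \<Prod>j\<in>T. c j b" M
      using M a(1) by (intro real_characterI[where a = a]) auto
    show ?thesis by (rule sum_mangoldt_bounded)
  qed
  then obtain B where B: "\<And>T N. T \<in> Pow I - {{}} \<Longrightarrow>
      \<bar>\<Sum>d=1..N. (\<Prod>i\<in>T. c i d) * mangoldt d / real d\<bar> \<le> B T" by metis
  define R where "R = (\<Sum>p\<in>prime_factors M. ln (real p))"
  have W_range: "0 \<le> W d \<and> W d \<le> 2 ^ card I" for d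
  proof -
    have "0 \<le> s i * c i d + 1 \<and> s i * c i d + 1 \<le> 2" if "i \<in> I" for i
      using range[OF that, of d] s[OF that] by auto
    then show ?thesis unfolding W_def using prod_mono[of I "\<lambda>i. s i * c i d + 1" "\<lambda>_. 2"]
      by (auto intro!: prod_nonneg)
  qed
  have upper: "(\<Sum>d=1..N. W d * (mangoldt d / real d)) \<le> 2 ^ card I * R" for N
  proof -
    \<comment> \<open>At a prime power coprime to \<open>M\<close> some nonzero \<open>c i d\<close>
      has the wrong sign, so its factor is \<open>1 - 1 = 0\<close>.\<close>
    have zero: "W d * (mangoldt d / real d) = 0" if "coprime d M" for d
    proof (cases "primepow d")
      case True
      then obtain i where i: "i \<in> I" "c i d \<noteq> s i" using none by blast
      then have "s i * c i d = -1" using range[OF i(1), of d] nonzero[OF i(1) that] s[OF i(1)] by auto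
      then have "W d = 0" unfolding W_def using i(1) by (intro prod_zero[OF fin] bexI[of _ i]) auto
      then show ?thesis by simp
    qed (simp add: mangoldt_def)
    have "(\<Sum>d=1..N. W d * (mangoldt d / real d)) =
        (\<Sum>d | d \<in> {1..N} \<and> \<not> coprime d M. W d * (mangoldt d / real d))"
    proof (rule sum.mono_neutral_right)
      show "\<forall>d\<in>{1..N} - {d. d \<in> {1..N} \<and> \<not> coprime d M}. W d * (mangoldt d / real d) = 0"
        using zero by blast
    qed auto
    also have "\<dots> \<le> (\<Sum>d | d \<in> {1..N} \<and> \<not> coprime d M. 2 ^ card I * (mangoldt d / real d))"
      using W_range by (intro sum_mono mult_right_mono divide_nonneg_nonneg mangoldt_nonneg) auto
    also have "\<dots> = 2 ^ card I * (\<Sum>d | d \<in> {1..N} \<and> \<not> coprime d M. mangoldt d / real d)"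
      by (rule sum_distrib_left[symmetric])
    also have "\<dots> \<le> 2 ^ card I * R"
      unfolding R_def using sum_mangoldt_not_coprime_le[OF M] by (intro mult_left_mono) auto
    finally show ?thesis .
  qed
  have lower: "ln (real N) - 1 - (\<Sum>T\<in>Pow I - {{}}. B T) \<le> (\<Sum>d=1..N. W d * (mangoldt d / real d))"
    if N: "N \<ge> 1" for N
  proof -
    let ?S = "\<lambda>T. (\<Prod>i\<in>T. s i) * (\<Sum>d=1..N. (\<Prod>i\<in>T. c i d) * mangoldt d / real d)"
    have "(\<Sum>d=1..N. W d * (mangoldt d / real d)) =
      (\<Sum>d=1..N. \<Sum>T\<in>Pow I. (\<Prod>i\<in>T. s i) * ((\<Prod>i\<in>T. c i d) * mangoldt d / real d))"
      unfolding W_def prod_add[OF fin] prod.distrib sum_distrib_right by (simp add: mult.assoc)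
    also have "\<dots> = (\<Sum>T\<in>Pow I. ?S T)"
      by (subst sum.swap) (simp add: sum_distrib_left)
    also have "\<dots> = ?S {} + (\<Sum>T\<in>Pow I - {{}}. ?S T)"
      using fin by (intro sum.remove) auto
    finally have eq: "(\<Sum>d=1..N. W d * (mangoldt d / real d)) = ?S {} + (\<Sum>T\<in>Pow I - {{}}. ?S T)" .
    have "\<bar>\<Sum>T\<in>Pow I - {{}}. ?S T\<bar> \<le> (\<Sum>T\<in>Pow I - {{}}. B T)"
    proof (intro sum_abs[THEN order_trans] sum_mono)
      fix T assume T: "T \<in> Pow I - {{}}"
      then have "\<bar>\<Prod>i\<in>T. s i\<bar> = 1" unfolding abs_prod using s by (intro prod.neutral) force
      then show "\<bar>?S T\<bar> \<le> B T" using B[OF T, of N] by (simp add: abs_mult)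
    qed
    moreover have "ln (real N) - 1 \<le> ?S {}" using sum_mangoldt_over_ge[OF N] by simp
    ultimately show ?thesis unfolding eq by linarith
  qed
  \<comment> \<open>Once \<open>ln N > K\<close> the lower bound exceeds the upper one, with 1 to
    spare.\<close>
  define K where "K = 2 + (\<Sum>T\<in>Pow I - {{}}. B T) + 2 ^ card I * R"
  obtain N :: nat where N: "exp K < real N" using reals_Archimedean2 by blast
  then have "N \<ge> 1" using exp_gt_zero[of K] by (cases N) auto
  have "ln (exp K) < ln (real N)" using N \<open>N \<ge> 1\<close> by (subst ln_less_cancel_iff) auto
  then have "K < ln (real N)" by simp
  then show False using lower[OF \<open>N \<ge> 1\<close>] upper[of N] unfolding K_def by linarith
qed

section \<open>Residue symbols\<close>

lemma Legendre_range: "Legendre a p \<in> {-1, 0, 1}"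
  by (auto simp: Legendre_def)

lemma eq_of_cong_of_sign:
  fixes a b p :: int
  assumes "[a = b] (mod p)" "a \<in> {-1, 0, 1}" "b \<in> {-1, 0, 1}" "2 < p"
  shows "a = b"
proof -
  have "p dvd a - b" using assms(1) by (simp add: cong_iff_dvd_diff)
  moreover have "\<bar>a - b\<bar> < p" using assms(2-4) by auto
  ultimately show ?thesis using dvd_imp_le_int[of "a - b" p] by fastforce
qed

lemma Legendre_mult:
  assumes "prime p" "2 < (p::nat)"
  shows "Legendre (a * b) p = Legendre a p * Legendre b p"
proof (rule eq_of_cong_of_sign)
  let ?k = "(p - 1) div 2"
  have "[Legendre (a * b) p = (a * b) ^ ?k] (mod p)" by (rule euler_criterion[OF assms])
  moreover have "[Legendre a p * Legendre b p = a ^ ?k * b ^ ?k] (mod p)"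
    by (intro cong_mult euler_criterion assms)
  ultimately show "[Legendre (a * b) p = Legendre a p * Legendre b p] (mod p)"
    unfolding power_mult_distrib using cong_sym cong_trans by blast
  show "Legendre a p * Legendre b p \<in> {-1, 0, 1}"
    using Legendre_range[of a p] Legendre_range[of b p] by auto
qed (use assms Legendre_range in auto)

lemma Legendre_cong:
  assumes "[a = b] (mod p)"
  shows "Legendre a p = Legendre b p"
proof -
  have "[a = 0] (mod p) \<longleftrightarrow> [b = 0] (mod p)" using assms cong_sym cong_trans by blast
  moreover have "QuadRes p a \<longleftrightarrow> QuadRes p b"
    unfolding QuadRes_def using assms cong_sym cong_trans by blast
  ultimately show ?thesis unfolding Legendre_def by simp
qed

lemma Legendre_1: "1 < p \<Longrightarrow> Legendre 1 p = 1"
proof -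
  assume "1 < p"
  then have "\<not> [1 = 0] (mod p)" using zdvd_imp_le[of p 1] by (auto simp: cong_0_iff)
  moreover have "QuadRes p 1" unfolding QuadRes_def by (intro exI[of _ 1]) simp
  ultimately show ?thesis unfolding Legendre_def by simp
qed

lemma Legendre_minus_one:
  assumes "prime p" "2 < (p::nat)"
  shows "Legendre (-1) p = (if p mod 4 = 1 then 1 else -1)"
proof -
  have "Legendre (-1) p = (-1) ^ ((p - 1) div 2)"
  proof (rule eq_of_cong_of_sign[OF euler_criterion[OF assms] Legendre_range])
    show "(- 1) ^ ((p - 1) div 2) \<in> {- 1, 0, 1::int}" by (cases "even ((p - 1) div 2)") auto
  qed (use assms in auto)
  moreover have "odd p" using assms by (simp add: prime_odd_nat)
  then have "even ((p - 1) div 2) \<longleftrightarrow> p mod 4 = 1" by presburger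
  ultimately show ?thesis by simp
qed

text \<open>A primitive root works: were it a residue, Euler's criterion would make its order divide
  \<open>(p - 1) div 2\<close>.\<close>

lemma exists_nonresidue:
  assumes "prime p" "2 < (p::nat)"
  shows "\<exists>a::nat. Legendre a p = -1"
proof -
  obtain g where g: "residue_primroot p g"
    using prime_primitive_root_exists[of p] assms prime_gt_1_nat[of p] by auto
  then have cop: "coprime p g" and ord: "ord p g = p - 1"
    using assms(1) by (auto simp: residue_primroot_def totient_prime)
  have "Legendre g p \<noteq> 1"
  proof
    assume "Legendre g p = 1"
    then have "[int (g ^ ((p - 1) div 2)) = int 1] (mod int p)"
      using cong_sym[OF euler_criterion[OF assms, of g]] by simp
    then have "[g ^ ((p - 1) div 2) = 1] (mod p)" by (subst (asm) cong_int_iff)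
    then have "p - 1 dvd (p - 1) div 2" using ord_divides[of g _ p] ord by simp
    then have "p - 1 \<le> (p - 1) div 2" using assms(2) by (intro dvd_imp_le) auto
    then show False using assms(2) by simp
  qed
  moreover have "\<not> [int g = 0] (mod int p)"
  proof
    assume "[int g = 0] (mod int p)"
    then have "p dvd g" by (simp add: cong_0_iff)
    then show False using coprime_absorb_left[of p g] cop assms(2) by simp
  qed
  ultimately have "Legendre g p = -1" unfolding Legendre_def by (auto split: if_splits)
  then show ?thesis by blast
qed

section \<open>The character modulo 4 and the auxiliary prime\<close>

text \<open>On odd primes this agrees with \<open>Legendre (-1) p\<close>; being multiplicative, it
  later collapses a product over the prime factors of \<open>m\<close> to
  \<open>chi4 m\<close>.\<close>

definition chi4 :: "nat \<Rightarrow> int" where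
  "chi4 n = (if n mod 4 = 1 then 1 else if n mod 4 = 3 then -1 else 0)"

lemma chi4_mult: "chi4 (a * b) = chi4 a * chi4 b"
proof -
  have eq: "a * b mod 4 = (a mod 4) * (b mod 4) mod 4" by (simp add: mod_mult_eq)
  have "a mod 4 \<in> {0, 1, 2, 3}" "b mod 4 \<in> {0, 1, 2, 3}" by auto
  then show ?thesis unfolding chi4_def eq by (elim insertE emptyE) simp_all
qed

lemma chi4_prod: "chi4 (prod f A) = (\<Prod>a\<in>A. chi4 (f a))"
  by (induction A rule: infinite_finite_induct) (simp_all add: chi4_mult, simp_all add: chi4_def)

lemma squarefree_eq_prod_prime_factors:
  assumes "squarefree (m::nat)" "m > 0"
  shows "m = \<Prod>(prime_factors m)"
proof -
  have "(\<Prod>p\<in>prime_factors m. p ^ multiplicity p m) = m" using prod_prime_factors[of m] assms(2) by simp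
  moreover have "multiplicity p m = 1" if "p \<in> prime_factors m" for p
    using assms squarefree_factorial_semiring'[of m] that by auto
  ultimately show ?thesis by simp
qed

text \<open>The characters are \<open>chi4\<close> and the Legendre symbols at the primes dividing
  \<open>m\<close>, all of period \<open>4 * m\<close> and independent by the Chinese remainder
  theorem. The prescribed values make \<open>-q\<close> a residue modulo each such prime.\<close>

lemma exists_prime_with_residue_symbols:
  fixes m :: nat
  assumes m: "squarefree m" "odd m"
  shows "\<exists>q::nat. (q = 1 \<or> prime q) \<and> q mod 4 = (1::nat) \<and>
    (\<forall>p\<in>prime_factors m. Legendre (int q) (int p) = Legendre (-1) (int p))"
proof -
  have m0: "m > 0" using m(2) by (auto intro: Nat.gr0I)
  have pf: "prime p \<and> p dvd m \<and> 2 < p" if "p \<in> prime_factors m" for p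
  proof -
    have "prime p" "p dvd m" using that by auto
    moreover from this m(2) have "p \<noteq> 2" by auto
    ultimately show ?thesis using prime_ge_2_nat[of p] by simp
  qed
  have four: "4 \<notin> prime_factors m" using pf[of 4] m(2) dvd_trans[of 2 4 m] by auto
  define I where "I = insert 4 (prime_factors m)"
  \<comment> \<open>The composite index 4 stands for the nontrivial character modulo 4.\<close>
  define c where "c i n = (if i = 4 then chi4 n else Legendre (int n) (int i))" for i n
  define s where "s i = (if i = 4 then 1 else Legendre (-1) (int i))" for i :: nat
  have c_mult: "c i (a * b) = c i a * c i b" if "i \<in> I" for i a b
    using that pf unfolding c_def I_def by (auto simp: chi4_mult Legendre_mult)
  have c_range: "c i a \<in> {-1, 0, 1}" for i a
    unfolding c_def using Legendre_range[of a i] by (auto simp: chi4_def)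
  have c_one: "c i 1 = 1" if "i \<in> I" for i
    using that pf[of i] Legendre_1[of "int i"] unfolding c_def I_def by (auto simp: chi4_def)
  have s_range: "s i \<in> {-1, 1}" if "i \<in> I" for i
    using that pf unfolding s_def I_def by (auto simp: Legendre_minus_one)
  have "\<exists>d. primepow d \<and> (\<forall>i\<in>I. real_of_int (c i d) = real_of_int (s i))"
  proof (rule exists_primepow_with_signs[where M = "4 * m"])
    fix i a assume i: "i \<in> I"
    have "(a + 4 * m) mod 4 = a mod 4" by simp
    moreover have "[int (a + 4 * m) = int a] (mod int i)" if "i \<noteq> 4"
    proof -
      have "i dvd 4 * m" using i that pf unfolding I_def by auto
      then have "int i dvd 4 * int m" using int_dvd_int_iff[of i "4 * m"] by simp
      then show ?thesis by (simp add: cong_iff_dvd_diff)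
    qed
    ultimately show "real_of_int (c i (a + 4 * m)) = real_of_int (c i a)"
      unfolding c_def chi4_def using Legendre_cong by auto
  next
    fix i a assume i: "i \<in> I" and cop: "coprime a (4 * m)"
    show "real_of_int (c i a) \<noteq> 0"
    proof (cases "i = 4")
      case True
      have "coprime a (2 * 2)" using cop by simp
      then have "coprime a 2" unfolding coprime_mult_right_iff by blast
      then have "odd a" by simp
      then have "a mod 4 = 1 \<or> a mod 4 = 3" by presburger
      then show ?thesis unfolding c_def chi4_def using True by auto
    next
      case False
      then have "prime i" "i dvd m" using i pf unfolding I_def by auto
      moreover have "\<not> i dvd a" using cop \<open>prime i\<close> \<open>i dvd m\<close>
        by (meson coprime_common_divisor_nat coprime_mult_right_iff not_prime_1 One_nat_def prime_nat_iff coprime_common_divisor not_prime_unit)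
      ultimately show ?thesis unfolding c_def Legendre_def using False by (auto simp: cong_0_iff)
    qed
  next
    fix i assume i: "i \<in> I"
    show "\<exists>a. coprime a (4 * m) \<and> real_of_int (c i a) = -1 \<and> (\<forall>j\<in>I - {i}. real_of_int (c j a) = 1)"
    proof (cases "i = 4")
      case True
      have "coprime (2 ^ 2) m" unfolding coprime_power_left_iff using m(2) by simp
      then have "coprime 4 m" by simp
      then obtain a where a: "[a = 3] (mod 4)" "[a = 1] (mod m)" using binary_chinese_remainder_nat by blast
      have "a mod 4 = 3" using a(1) by (simp add: Cong.cong_def)
      then have "odd a" by presburger
      then have "coprime a (2 ^ 2)" unfolding coprime_power_right_iff by simp
      then have "coprime a 4" by simp
      moreover have "coprime a m" using cong_imp_coprime[OF cong_sym[OF a(2)]] by simp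
      moreover have "c 4 a = -1" using a(1) unfolding c_def chi4_def Cong.cong_def by simp
      moreover have "c j a = 1" if j: "j \<in> I - {i}" for j
      proof -
        have jp: "prime j" "j dvd m" "2 < j" "j \<noteq> 4" using j True pf unfolding I_def by auto
        then have "[a = 1] (mod j)" using a(2) cong_dvd_modulus_nat by blast
        then have "[int a = 1] (mod int j)" using cong_int_iff[of a 1 j] by simp
        then show ?thesis unfolding c_def using Legendre_cong[of "int a" 1 "int j"] Legendre_1[of "int j"] jp by simp
      qed
      ultimately show ?thesis using True by (intro exI[of _ a]) simp
    next
      case False
      then have p: "prime i" "i dvd m" "2 < i" using i pf unfolding I_def by auto
      obtain r :: nat where r: "Legendre r i = -1" using exists_nonresidue p(1,3) by blast
      obtain m' where m': "m = i * m'" using p(2) by (elim dvdE)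
      \<comment> \<open>Squarefreeness makes \<open>i\<close> coprime to \<open>4 * m'\<close>, so
        the residue at \<open>i\<close> can be chosen freely while all other characters see
        1.\<close>
      have "\<not> i dvd m'" using m(1) p(1) squarefreeD[of m i] unfolding m' power2_eq_square
        using mult_dvd_mono[of i i i m'] by (auto simp: prime_nat_iff)
      then have "coprime i m'" using p(1) prime_imp_coprime by blast
      moreover have "coprime i (2 ^ 2)" unfolding coprime_power_right_iff using p(1,3) by (simp add: prime_odd_nat)
      then have "coprime i 4" by simp
      ultimately have "coprime i (4 * m')" by simp
      then obtain a where a: "[a = r] (mod i)" "[a = 1] (mod 4 * m')" using binary_chinese_remainder_nat by blast
      have "\<not> i dvd a"
      proof
        assume "i dvd a"
        then have "[int r = 0] (mod int i)" using cong_dvd_iff[OF a(1)] by (simp add: cong_0_iff cong_dvd_iff)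
        then show False using r unfolding Legendre_def by simp
      qed
      then have "coprime a i" using p(1) prime_imp_coprime coprime_commute by blast
      moreover have "coprime a (4 * m')" using cong_imp_coprime[OF cong_sym[OF a(2)]] by simp
      ultimately have "coprime a (4 * m)" unfolding m' by simp
      moreover have "c i a = -1"
      proof -
        have "[int a = int r] (mod int i)" using a(1) by (simp add: cong_int_iff)
        then show ?thesis unfolding c_def using Legendre_cong r False by simp
      qed
      moreover have "c j a = 1" if j: "j \<in> I - {i}" for j
      proof (cases "j = 4")
        case True
        have "[a = 1] (mod 4)" using a(2) cong_dvd_modulus_nat dvd_triv_left by blast
        then show ?thesis unfolding c_def chi4_def Cong.cong_def using True by simp
      next
        case False
        then have jp: "prime j" "j dvd m" "2 < j" using j pf unfolding I_def by auto
        have "j dvd m'" using jp j p(1) m' primes_dvd_imp_eq prime_dvd_mult_iff[of j i m'] by auto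
        then have "[a = 1] (mod j)" using a(2) cong_dvd_modulus_nat dvd_mult by blast
        then have "[int a = 1] (mod int j)" using cong_int_iff[of a 1 j] by simp
        then show ?thesis unfolding c_def using Legendre_cong[of "int a" 1 "int j"] Legendre_1[of "int j"] jp False by simp
      qed
      ultimately show ?thesis by (intro exI[of _ a]) simp
    qed
  next
    fix i a b assume i: "i \<in> I"
    show "real_of_int (c i (a * b)) = real_of_int (c i a) * real_of_int (c i b)"
      using c_mult[OF i] by simp
    show "real_of_int (c i 1) = 1" using c_one[OF i] by simp
    show "real_of_int (c i a) \<in> {-1, 0, 1}" using c_range[of i a] by auto
    show "real_of_int (s i) \<in> {-1, 1}" using s_range[OF i] by auto
  qed (use m0 in \<open>auto simp: I_def\<close>)
  then obtain d where d: "primepow d" "\<And>i. i \<in> I \<Longrightarrow> c i d = s i" by auto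
  then obtain q k where q: "prime q" "k > 0" "d = q ^ k" unfolding primepow_def by auto
  have power: "c i (q ^ k) = c i q ^ k" if "i \<in> I" for i
    using that c_one c_mult by (induction k) auto
  have result: "(q = 1 \<or> prime q) \<Longrightarrow> (\<And>i. i \<in> I \<Longrightarrow> c i q = s i) \<Longrightarrow> ?thesis" for q :: nat
  proof -
    assume q: "q = 1 \<or> prime q" and cs: "\<And>i. i \<in> I \<Longrightarrow> c i q = s i"
    have "q mod 4 = 1" using cs[of 4] unfolding I_def c_def s_def chi4_def by (auto split: if_splits)
    moreover have "Legendre q p = Legendre (-1) p" if "p \<in> prime_factors m" for p
      using cs[of p] that four unfolding I_def c_def s_def by (cases "p = 4") auto
    ultimately show ?thesis using q by auto
  qed
  \<comment> \<open>An odd power of q has the same signs as q; an even one forces all signs to be 1.\<close>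
  show ?thesis
  proof (cases "even k")
    case True
    have "c i 1 = s i" if "i \<in> I" for i
    proof -
      have "c i q ^ k = s i" using d(2)[OF that] q(3) power[OF that] by simp
      then show ?thesis using s_range[OF that] c_one[OF that] True zero_le_even_power[of k "c i q"] by auto
    qed
    then show ?thesis using result[of 1] by simp
  next
    case False
    have "c i q = s i" if "i \<in> I" for i
    proof -
      have "c i q ^ k = s i" using d(2)[OF that] q(3) power[OF that] by simp
      then show ?thesis using c_range[of i q] False q(2) by (auto simp: power_0_left)
    qed
    then show ?thesis using result[of q] q(1) by simp
  qed
qed

section \<open>Sums of squares\<close>

lemma nearest_multiple_int:
  fixes a b :: int
  assumes "b > 0"
  obtains k where "\<bar>2 * (a - k * b)\<bar> \<le> b"
proof -
  \<comment> \<open>The quotient of \<open>2 * a + b\<close> by \<open>2 * b\<close> is the floor of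
    \<open>a / b + 1/2\<close>, the rounding of \<open>a / b\<close>.\<close>
  let ?t = "2 * a + b"
  have "?t = (?t div (2 * b)) * (2 * b) + ?t mod (2 * b)" by (rule div_mult_mod_eq[symmetric])
  moreover have "0 \<le> ?t mod (2 * b)" "?t mod (2 * b) < 2 * b" using assms by auto
  ultimately have "\<bar>2 * (a - (?t div (2 * b)) * b)\<bar> \<le> b" by (simp add: algebra_simps abs_le_iff)
  then show thesis by (rule that)
qed

lemma power2_le_of_abs_double_le:
  fixes x b :: int
  assumes "\<bar>2 * x\<bar> \<le> b"
  shows "4 * x\<^sup>2 \<le> b\<^sup>2"
  using power_mono[OF assms, of 2] by (simp add: power_mult_distrib)

text \<open>Real coordinates for factoring the Hermitian matrix with diagonal \<open>p\<close>,
  \<open>r\<close> and upper entry \<open>x + i y\<close> as \<open>g g^*\<close> with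
  \<open>det g = 1\<close>. Translating \<open>x + i y\<close> by a nearest multiple of
  \<open>p\<close> makes \<open>p * r' \<le> 1 + p^2 / 2\<close>, below \<open>p^2\<close> for
  \<open>p \<ge> 2\<close>; swapping the diagonal entries then gives a smaller instance.\<close>

lemma unimodular_hermitian_form_factorization:
  fixes p r x y :: int
  assumes "p > 0" "p * r = 1 + x\<^sup>2 + y\<^sup>2"
  shows "\<exists>a1 a2 b1 b2 c1 c2 d1 d2.
    p = a1\<^sup>2 + a2\<^sup>2 + b1\<^sup>2 + b2\<^sup>2 \<and> r = c1\<^sup>2 + c2\<^sup>2 + d1\<^sup>2 + d2\<^sup>2 \<and>
    x = a1 * c1 + a2 * c2 + b1 * d1 + b2 * d2 \<and>
    y = a2 * c1 - a1 * c2 + b2 * d1 - b1 * d2 \<and>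
    (a1 * d1 - a2 * d2) - (b1 * c1 - b2 * c2) = 1 \<and>
    (a1 * d2 + a2 * d1) - (b1 * c2 + b2 * c1) = 0"
  using assms
proof (induction "nat p" arbitrary: p r x y rule: less_induct)
  case less
  show ?case
  proof (cases "p = 1")
    case True
    then show ?thesis using less.prems
      apply (rule_tac exI[of _ 1], rule_tac exI[of _ 0], rule_tac exI[of _ 0], rule_tac exI[of _ 0])
      apply (rule_tac exI[of _ x], rule_tac exI[of _ "-y"], rule_tac exI[of _ 1], rule_tac exI[of _ 0])
      by simp
  next
    case False
    obtain k where k: "\<bar>2 * (x - k * p)\<bar> \<le> p" using nearest_multiple_int[OF less.prems(1)] .
    obtain l where l: "\<bar>2 * (y - l * p)\<bar> \<le> p" using nearest_multiple_int[OF less.prems(1)] .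
    define x' where "x' = x - k * p"
    define y' where "y' = y - l * p"
    define r' where "r' = r - 2 * (k * x + l * y) + (k\<^sup>2 + l\<^sup>2) * p"
    have "p * r' = p * r - 2 * p * (k * x + l * y) + (k\<^sup>2 + l\<^sup>2) * p\<^sup>2"
      unfolding r'_def by (simp add: algebra_simps power2_eq_square)
    then have eq: "p * r' = 1 + x'\<^sup>2 + y'\<^sup>2"
      unfolding x'_def y'_def less.prems(2) by (simp add: algebra_simps power2_eq_square)
    then have "0 < p * r'" using zero_le_power2[of x'] zero_le_power2[of y'] by linarith
    then have "0 < r'" using less.prems(1) zero_less_mult_pos by blast
    have "4 * x'\<^sup>2 \<le> p\<^sup>2" "4 * y'\<^sup>2 \<le> p\<^sup>2"
      using k l unfolding x'_def y'_def by (auto intro!: power2_le_of_abs_double_le)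
    moreover have "2 * 2 \<le> p * p" using False less.prems(1) by (intro mult_mono) auto
    ultimately have "p * r' < p * p" using eq by (simp add: power2_eq_square)
    then have "r' < p" using less.prems(1) by simp
    \<comment> \<open>The swap is conjugation by a matrix of determinant 1, which sends the upper
      entry \<open>x' + i y'\<close> to minus its conjugate, \<open>- x' + i y'\<close>.\<close>
    obtain a1 a2 b1 b2 c1 c2 d1 d2 where IH:
      "r' = a1\<^sup>2 + a2\<^sup>2 + b1\<^sup>2 + b2\<^sup>2" "p = c1\<^sup>2 + c2\<^sup>2 + d1\<^sup>2 + d2\<^sup>2"
      "- x' = a1 * c1 + a2 * c2 + b1 * d1 + b2 * d2"
      "y' = a2 * c1 - a1 * c2 + b2 * d1 - b1 * d2"
      "(a1 * d1 - a2 * d2) - (b1 * c1 - b2 * c2) = 1"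
      "(a1 * d2 + a2 * d1) - (b1 * c2 + b2 * c1) = 0"
      using less.hyps[of r' p "- x'" y'] \<open>0 < r'\<close> \<open>r' < p\<close> eq less.prems(1)
      by (auto simp: mult.commute)
    have x: "x = k * p - (a1 * c1 + a2 * c2 + b1 * d1 + b2 * d2)"
      using IH(3) unfolding x'_def by simp
    have y: "y = l * p + (a2 * c1 - a1 * c2 + b2 * d1 - b1 * d2)"
      using IH(4) unfolding y'_def by simp
    have r: "r = (a1\<^sup>2 + a2\<^sup>2 + b1\<^sup>2 + b2\<^sup>2) + 2 * (k * x + l * y) - (k\<^sup>2 + l\<^sup>2) * p"
      using IH(1) unfolding r'_def by simp
    have det:
      "((- c1) * (b1 - (k * d1 + l * d2)) - (- c2) * (b2 - (k * d2 - l * d1))) -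
       ((- d1) * (a1 - (k * c1 + l * c2)) - (- d2) * (a2 - (k * c2 - l * c1))) = 1"
      "((- c1) * (b2 - (k * d2 - l * d1)) + (- c2) * (b1 - (k * d1 + l * d2))) -
       ((- d1) * (a2 - (k * c2 - l * c1)) + (- d2) * (a1 - (k * c1 + l * c2))) = 0"
      unfolding IH(5,6)[symmetric] by (simp_all add: algebra_simps)
    \<comment> \<open>Undoing swap and translation: the first row is minus the old second row, and
      the second is the old first row minus \<open>k - i l\<close> times the old second.\<close>
    show ?thesis
      apply (rule exI[of _ "-c1"], rule exI[of _ "-c2"], rule exI[of _ "-d1"], rule exI[of _ "-d2"])
      apply (rule exI[of _ "a1 - (k * c1 + l * c2)"], rule exI[of _ "a2 - (k * c2 - l * c1)"])
      apply (rule exI[of _ "b1 - (k * d1 + l * d2)"], rule exI[of _ "b2 - (k * d2 - l * d1)"])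
      unfolding r x y IH(2)
      by (intro conjI) (rule det | simp add: algebra_simps power2_eq_square)+
  qed
qed

text \<open>The same descent for real symmetric matrices. When \<open>x\<close> is a square root of
  -1 modulo \<open>p\<close>, it writes \<open>p\<close> as a sum of two squares.\<close>

lemma sum_two_squares_of_unimodular_form:
  fixes p r x :: int
  assumes "p > 0" "p * r = 1 + x\<^sup>2"
  shows "\<exists>a b c d. p = a\<^sup>2 + b\<^sup>2 \<and> r = c\<^sup>2 + d\<^sup>2 \<and> x = a * c + b * d"
  using assms
proof (induction "nat p" arbitrary: p r x rule: less_induct)
  case less
  show ?case
  proof (cases "p = 1")
    case True
    then show ?thesis using less.prems
      apply (rule_tac exI[of _ 1], rule_tac exI[of _ 0], rule_tac exI[of _ x], rule_tac exI[of _ 1])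
      by simp
  next
    case False
    obtain k where k: "\<bar>2 * (x - k * p)\<bar> \<le> p" using nearest_multiple_int[OF less.prems(1)] .
    define x' where "x' = x - k * p"
    define r' where "r' = r - 2 * k * x + k\<^sup>2 * p"
    have eq: "p * r' = 1 + x'\<^sup>2"
      unfolding r'_def x'_def using less.prems(2) by (simp add: algebra_simps power2_eq_square)
    then have "0 < p * r'" using zero_le_power2[of x'] by linarith
    then have "0 < r'" using less.prems(1) zero_less_mult_pos by blast
    have "4 * x'\<^sup>2 \<le> p\<^sup>2" using k unfolding x'_def by (auto intro!: power2_le_of_abs_double_le)
    moreover have "2 * 2 \<le> p * p" using False less.prems(1) by (intro mult_mono) auto
    ultimately have "p * r' < p * p" using eq by (simp add: power2_eq_square)
    then have "r' < p" using less.prems(1) by simp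
    obtain a b c d where IH: "r' = a\<^sup>2 + b\<^sup>2" "p = c\<^sup>2 + d\<^sup>2" "x' = a * c + b * d"
      using less.hyps[of r' p x'] \<open>0 < r'\<close> \<open>r' < p\<close> eq less.prems(1)
      by (auto simp: mult.commute)
    have x: "x = k * p + (a * c + b * d)"
      using IH(3) unfolding x'_def by simp
    have r: "r = (a\<^sup>2 + b\<^sup>2) + 2 * k * x - k\<^sup>2 * p"
      using IH(1) unfolding r'_def by simp
    show ?thesis
      apply (rule exI[of _ c], rule exI[of _ d], rule exI[of _ "a + k * c"], rule exI[of _ "b + k * d"])
      unfolding r x IH(2) by (intro conjI) (simp_all add: algebra_simps power2_eq_square)
  qed
qed

text \<open>The Davenport--Cassels descent: join the rational point \<open>(a, b, c) / y\<close> of the sphere to a nearest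
  integral point and take the second intersection with the sphere.\<close>
lemma sum_three_squares_of_rational:
  fixes m y a b c :: int
  assumes "y > 0" "m * y\<^sup>2 = a\<^sup>2 + b\<^sup>2 + c\<^sup>2"
  shows "\<exists>u v w. m = u\<^sup>2 + v\<^sup>2 + w\<^sup>2"
  using assms
proof (induction "nat y" arbitrary: y a b c rule: less_induct)
  case less
  obtain u where u: "\<bar>2 * (a - u * y)\<bar> \<le> y" using nearest_multiple_int[OF less.prems(1)] .
  obtain v where v: "\<bar>2 * (b - v * y)\<bar> \<le> y" using nearest_multiple_int[OF less.prems(1)] .
  obtain w where w: "\<bar>2 * (c - w * y)\<bar> \<le> y" using nearest_multiple_int[OF less.prems(1)] .
  define R where "R = (a - u * y)\<^sup>2 + (b - v * y)\<^sup>2 + (c - w * y)\<^sup>2"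
  \<comment> \<open>The second intersection is
    \<open>(A * a + B * u, A * b + B * v, A * c + B * w) / y'\<close>. The squared distance from the
    given point to the nearest integral one is \<open>y' / y\<close>, at most 3/4 as each coordinate
    is off by at most 1/2.\<close>
  define A where "A = u\<^sup>2 + v\<^sup>2 + w\<^sup>2 - m"
  define B where "B = 2 * (m * y - (a * u + b * v + c * w))"
  define y' where "y' = A * y + B"
  have R: "R = y * y'"
  proof -
    have "R = m * y\<^sup>2 - 2 * y * (a * u + b * v + c * w) + y\<^sup>2 * (A + m)"
      unfolding R_def A_def less.prems(2) by (simp add: algebra_simps power2_eq_square)
    also have "\<dots> = y * y'" unfolding y'_def B_def by (simp add: algebra_simps power2_eq_square)
    finally show ?thesis .
  qed
  have "4 * R \<le> 3 * y\<^sup>2"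
    using power2_le_of_abs_double_le[OF u] power2_le_of_abs_double_le[OF v]
      power2_le_of_abs_double_le[OF w] unfolding R_def by simp
  then have "y * (4 * y') \<le> y * (3 * y)" unfolding R by (simp add: power2_eq_square)
  then have le: "4 * y' \<le> 3 * y" using less.prems(1) by simp
  have "0 \<le> y * y'" unfolding R[symmetric] R_def by simp
  then have "0 \<le> y'" using less.prems(1) by (simp add: zero_le_mult_iff)
  show ?case
  proof (cases "y' = 0")
    case True
    then have 0: "(a - u * y)\<^sup>2 + (b - v * y)\<^sup>2 + (c - w * y)\<^sup>2 = 0" using R unfolding R_def by simp
    have "a - u * y = 0 \<and> b - v * y = 0 \<and> c - w * y = 0"
      using 0 zero_le_power2[of "a - u * y"] zero_le_power2[of "b - v * y"] zero_le_power2[of "c - w * y"]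
      by (metis add_nonneg_eq_0_iff add_nonneg_nonneg power_eq_0_iff)
    then have "a = u * y" "b = v * y" "c = w * y" by auto
    then have "y\<^sup>2 * m = y\<^sup>2 * (u\<^sup>2 + v\<^sup>2 + w\<^sup>2)" using less.prems(2) by (simp add: algebra_simps power2_eq_square)
    then show ?thesis using less.prems(1) by auto
  next
    case False
    have "m * y'\<^sup>2 = (A * a + B * u)\<^sup>2 + (A * b + B * v)\<^sup>2 + (A * c + B * w)\<^sup>2"
    proof -
      have "(A * a + B * u)\<^sup>2 + (A * b + B * v)\<^sup>2 + (A * c + B * w)\<^sup>2 =
        A\<^sup>2 * (m * y\<^sup>2) + 2 * A * B * (a * u + b * v + c * w) + B\<^sup>2 * (A + m)"
        unfolding less.prems(2) unfolding A_def by (simp add: algebra_simps power2_eq_square)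
      also have "2 * A * B * (a * u + b * v + c * w) = A * B * (2 * m * y - B)"
        unfolding B_def by (simp add: algebra_simps)
      also have "A\<^sup>2 * (m * y\<^sup>2) + A * B * (2 * m * y - B) + B\<^sup>2 * (A + m) = m * y'\<^sup>2"
        unfolding y'_def by (simp add: algebra_simps power2_eq_square)
      finally show ?thesis by simp
    qed
    then show ?thesis using less.hyps[of y'] False \<open>0 \<le> y'\<close> le by auto
  qed
qed

section \<open>An isotropic vector of the ternary form\<close>

lemma Legendre_prod:
  assumes "prime p" "2 < (p::nat)"
  shows "Legendre (prod f A) p = (\<Prod>a\<in>A. Legendre (f a) p)"
  using assms by (induction A rule: infinite_finite_induct) (simp_all add: Legendre_mult Legendre_1)

text \<open>A squarefree \<open>m\<close> is the product of its distinct prime factors, so roots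
  modulo these primes glue by the Chinese remainder theorem.\<close>

lemma exists_square_root_mod:
  assumes "squarefree (m::nat)" "m > 0" and res: "\<And>p. p \<in> prime_factors m \<Longrightarrow> QuadRes p a"
  shows "\<exists>h. int m dvd h\<^sup>2 - a"
proof -
  have "\<exists>y::nat. [int y ^ 2 = a] (mod int p)" if p: "p \<in> prime_factors m" for p
  proof -
    obtain y where y: "[y\<^sup>2 = a] (mod int p)" using res[OF p] unfolding QuadRes_def by blast
    have "0 < p" using p by (auto intro: Nat.gr0I)
    then have "[int (nat (y mod p)) = y] (mod int p)" by simp
    then have "[int (nat (y mod p)) ^ 2 = a] (mod int p)" using y cong_pow cong_trans by blast
    then show ?thesis by blast
  qed
  then obtain u :: "nat \<Rightarrow> nat" where u: "\<And>p. p \<in> prime_factors m \<Longrightarrow> [int (u p) ^ 2 = a] (mod int p)" by metis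
  have cop: "\<forall>i\<in>prime_factors m. \<forall>j\<in>prime_factors m. i \<noteq> j \<longrightarrow> coprime i j"
    using primes_coprime by (metis in_prime_factors_imp_prime)
  obtain h where h: "\<forall>p\<in>prime_factors m. [h = u p] (mod p)"
    using chinese_remainder_nat[of "prime_factors m" "\<lambda>p. p" u] cop by auto
  have "\<forall>p\<in>prime_factors m. [int h ^ 2 = a] (mod int p)"
    using h u cong_pow cong_trans cong_int_iff by blast
  then have "[int h ^ 2 = a] (mod (\<Prod>p\<in>prime_factors m. int p))"
    using cop by (intro cong_cong_prod_coprime) auto
  also have "(\<Prod>p\<in>prime_factors m. int p) = int m"
    unfolding of_nat_prod[of "\<lambda>p. p", symmetric] squarefree_eq_prod_prime_factors[OF assms(1,2), symmetric] ..
  finally show ?thesis by (auto simp: cong_iff_dvd_diff)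
qed

lemma sum_two_squares_prime:
  assumes "prime (q::nat)" "q mod 4 = 1"
  shows "\<exists>u v. int q = u\<^sup>2 + v\<^sup>2"
proof -
  have "2 < q" using assms prime_ge_2_nat[of q] by (cases "q = 2") auto
  then have "QuadRes q (-1)"
    using Legendre_minus_one[OF assms(1)] assms(2) unfolding Legendre_def by (auto split: if_splits)
  then obtain t where "[t\<^sup>2 = -1] (mod int q)" unfolding QuadRes_def by blast
  then obtain r where "1 + t\<^sup>2 = int q * r" by (auto simp: cong_iff_dvd_diff add.commute elim: dvdE)
  then show ?thesis using sum_two_squares_of_unimodular_form[of "int q" r t] \<open>2 < q\<close> by auto
qed

text \<open>Pigeonhole: a box with sides the square roots of \<open>m * q\<close>, \<open>q\<close>
  and \<open>m\<close> holds more than \<open>m * q\<close> integral points, and two of them agree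
  in both residues; their difference is small.\<close>

lemma exists_small_lattice_point:
  fixes m q :: nat and h g :: int
  assumes "m > 0" "q > 0"
  obtains x y z where "(x, y, z) \<noteq> (0, 0, 0)" "x\<^sup>2 \<le> int (m * q)" "y\<^sup>2 \<le> int q" "z\<^sup>2 \<le> int m"
    "int m dvd x - h * z" "int q dvd x - g * y"
proof -
  define X Y Z where "X = floor_sqrt (m * q)" and "Y = floor_sqrt q" and "Z = floor_sqrt m"
  have up: "n < (Suc (floor_sqrt n))\<^sup>2" and low: "(floor_sqrt n)\<^sup>2 \<le> n" for n
    by (rule Suc_floor_sqrt_power2_gt) (rule floor_sqrt_power2_le)
  define D where "D = {0..int X} \<times> {0..int Y} \<times> {0..int Z}"
  define f where "f = (\<lambda>(x, y, z). ((x - h * z) mod int m, (x - g * y) mod int q))"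
  have "(m * q)\<^sup>2 = (m * q) * q * m" by (simp add: power2_eq_square)
  also have "\<dots> < (Suc X)\<^sup>2 * (Suc Y)\<^sup>2 * (Suc Z)\<^sup>2"
    unfolding X_def Y_def Z_def using up assms by (intro mult_strict_mono) auto
  also have "\<dots> = (Suc X * Suc Y * Suc Z)\<^sup>2" by (simp only: power_mult_distrib)
  finally have "m * q < Suc X * Suc Y * Suc Z" by (rule power_less_imp_less_base) simp
  moreover have "card D = Suc X * Suc Y * Suc Z" 
  proof -
    have "card {0..int n} = Suc n" for n by simp
    then show ?thesis unfolding D_def card_cartesian_product by (simp only: mult.assoc)
  qed
  moreover have "f ` D \<subseteq> {0..<int m} \<times> {0..<int q}" unfolding f_def using assms by auto
  then have "card (f ` D) \<le> m * q"
    using card_mono[of "{0..<int m} \<times> {0..<int q}" "f ` D"] by (simp add: card_cartesian_product)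
  ultimately have "\<not> inj_on f D" by (intro pigeonhole) simp
  then obtain v w where vw: "v \<in> D" "w \<in> D" "v \<noteq> w" "f v = f w" unfolding inj_on_def by blast
  obtain x1 y1 z1 x2 y2 z2 where v: "v = (x1, y1, z1)" "w = (x2, y2, z2)" by (metis prod_cases3)
  have small: "(a - b)\<^sup>2 \<le> int n" if "a \<in> {0..int (floor_sqrt n)}" "b \<in> {0..int (floor_sqrt n)}" for a b n
  proof -
    have "\<bar>a - b\<bar>\<^sup>2 \<le> (int (floor_sqrt n))\<^sup>2" using that by (intro power_mono) auto
    also have "\<dots> \<le> int n" using low[of n] by (metis of_nat_le_iff of_nat_power)
    finally show ?thesis by simp
  qed
  have "int m dvd (x1 - h * z1) - (x2 - h * z2)" "int q dvd (x1 - g * y1) - (x2 - g * y2)"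
    using vw(4) unfolding v f_def by (auto simp: mod_eq_dvd_iff)
  then have "int m dvd (x1 - x2) - h * (z1 - z2)" "int q dvd (x1 - x2) - g * (y1 - y2)"
    by (simp_all add: algebra_simps)
  moreover have "(x1 - x2, y1 - y2, z1 - z2) \<noteq> (0, 0, 0)" using vw(3) unfolding v by auto
  moreover have "(x1 - x2)\<^sup>2 \<le> int (m * q)" "(y1 - y2)\<^sup>2 \<le> int q" "(z1 - z2)\<^sup>2 \<le> int m"
    using vw(1,2) unfolding v D_def X_def Y_def Z_def mem_Sigma_iff by (blast intro: small)+
  ultimately show thesis using that by blast
qed

text \<open>At a small lattice point \<open>V = x^2 + q * z^2 - m * y^2\<close> is divisible by
  \<open>m\<close> (as \<open>h^2\<close> is \<open>-q\<close>) and by \<open>q\<close> (as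
  \<open>g^2\<close> is \<open>m\<close>), and lies between \<open>- m * q\<close> and
  \<open>2 * m * q\<close>. The end values would force \<open>y^2 = q\<close> or
  \<open>x^2 = m * q\<close>, which is impossible.\<close>

lemma ternary_form_isotropic:
  fixes m q :: nat and h g :: int
  assumes "m > 0" "prime q" "coprime m q" "int m dvd h\<^sup>2 + int q" "int q dvd g\<^sup>2 - int m"
  obtains x y z where "y > 0" "int m * y\<^sup>2 = x\<^sup>2 + int q * z\<^sup>2"
proof -
  have q0: "q > 0" using assms(2) prime_gt_0_nat by blast
  obtain x y z where nz: "(x, y, z) \<noteq> (0, 0, 0)"
    and le: "x\<^sup>2 \<le> int (m * q)" "y\<^sup>2 \<le> int q" "z\<^sup>2 \<le> int m"
    and dvd: "int m dvd x - h * z" "int q dvd x - g * y"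
    using exists_small_lattice_point[OF assms(1) q0] .
  define V where "V = x\<^sup>2 + int q * z\<^sup>2 - int m * y\<^sup>2"
  have "V = (x - h * z) * (x + h * z) + (h\<^sup>2 + int q) * z\<^sup>2 - int m * y\<^sup>2"
    unfolding V_def by (simp add: algebra_simps power2_eq_square)
  also have "int m dvd \<dots>"
    by (rule dvd_diff[OF dvd_add[OF dvd_mult2[OF dvd(1)] dvd_mult2[OF assms(4)]] dvd_triv_left])
  finally have mV: "int m dvd V" .
  have "V = (x - g * y) * (x + g * y) + (g\<^sup>2 - int m) * y\<^sup>2 + int q * z\<^sup>2"
    unfolding V_def by (simp add: algebra_simps power2_eq_square)
  also have "int q dvd \<dots>"
    by (rule dvd_add[OF dvd_add[OF dvd_mult2[OF dvd(2)] dvd_mult2[OF assms(5)]] dvd_triv_left])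
  finally have "int m * int q dvd V" using mV assms(3) by (intro divides_mult) auto
  then obtain k where k: "V = int m * int q * k" by (elim dvdE)
  have mq: "0 < int m * int q" using assms(1) q0 by simp
  have b: "int q * z\<^sup>2 \<le> int q * int m" "int m * y\<^sup>2 \<le> int m * int q"
    using le by (auto intro: mult_left_mono)
  then have b: "x\<^sup>2 \<le> int m * int q" "int q * z\<^sup>2 \<le> int m * int q" "int m * y\<^sup>2 \<le> int m * int q"
    using le(1) by (simp_all only: of_nat_mult mult.commute)
  have nn: "0 \<le> x\<^sup>2" "0 \<le> int q * z\<^sup>2" "0 \<le> int m * y\<^sup>2" by auto
  have "int m * int q * (-1) \<le> int m * int q * k" "int m * int q * k \<le> int m * int q * 2"
    unfolding k[symmetric] V_def using b nn by linarith+
  then have "-1 \<le> k" "k \<le> 2" unfolding mult_le_cancel_left_pos[OF mq] by blast+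
  moreover have "k \<noteq> -1"
  proof
    assume "k = -1"
    then have "V = - (int m * int q)" using k by simp
    then have "int m * y\<^sup>2 = int m * int q" using b nn unfolding V_def by linarith
    then have "y\<^sup>2 = int q" using assms(1) by simp
    then have "int ((nat \<bar>y\<bar>)\<^sup>2) = int q" by simp
    then have "(nat \<bar>y\<bar>)\<^sup>2 = q" by (simp only: of_nat_eq_iff)
    then show False using assms(2) prime_power_iff[of "nat \<bar>y\<bar>" 2] by simp
  qed
  moreover have "k \<noteq> 2"
  proof
    assume "k = 2"
    then have "V = 2 * (int m * int q)" using k by simp
    then have "x\<^sup>2 = int m * int q" using b nn unfolding V_def by linarith
    then have "int ((nat \<bar>x\<bar>)\<^sup>2) = int (m * q)" by simp
    then have eq: "(nat \<bar>x\<bar>)\<^sup>2 = m * q" by (simp only: of_nat_eq_iff)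
    then have "q dvd (nat \<bar>x\<bar>)\<^sup>2" by simp
    then have "q dvd nat \<bar>x\<bar>" using assms(2) prime_dvd_power by blast
    then have "q * q dvd m * q" unfolding eq[symmetric] power2_eq_square by (intro mult_dvd_mono)
    then have "q dvd m" using q0 by simp
    then show False using assms(2,3) coprime_absorb_right[of q m] by simp
  qed
  ultimately consider "k = 0" | "k = 1" by linarith
  then show thesis
  proof cases
    case 1
    then have eq: "int m * y\<^sup>2 = x\<^sup>2 + int q * z\<^sup>2" using k unfolding V_def by simp
    have "y \<noteq> 0"
    proof
      assume "y = 0"
      then have "x\<^sup>2 + int q * z\<^sup>2 = 0" using eq by simp
      then have "x\<^sup>2 = 0" "int q * z\<^sup>2 = 0" using nn by linarith+
      then show False using nz \<open>y = 0\<close> q0 by simp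
    qed
    then show thesis using that[of "\<bar>y\<bar>" x z] eq by simp
  next
    case 2
    \<comment> \<open>Multiply \<open>x\<^sup>2 + q z\<^sup>2 = m (y\<^sup>2 + q)\<close> by the norm \<open>y\<^sup>2 + q\<close>.\<close>
    then have eq: "x\<^sup>2 + int q * z\<^sup>2 = int m * (y\<^sup>2 + int q)" using k unfolding V_def by (simp add: algebra_simps)
    have "int m * (y\<^sup>2 + int q)\<^sup>2 = (y\<^sup>2 + int q) * (x\<^sup>2 + int q * z\<^sup>2)"
      unfolding eq by (simp add: power2_eq_square)
    also have "\<dots> = (x * y + int q * z)\<^sup>2 + int q * (x - y * z)\<^sup>2"
      by (simp add: algebra_simps power2_eq_square)
    finally show thesis using q0 by (intro that[of "y\<^sup>2 + int q"]) (auto intro: add_nonneg_pos)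
  qed
qed

section \<open>Three squares for numbers congruent to 1 modulo 4\<close>

lemma sum_three_squares_of_squarefree:
  fixes m :: nat
  assumes m: "squarefree m" "m mod 4 = 1"
  shows "\<exists>u v w. int m = u\<^sup>2 + v\<^sup>2 + w\<^sup>2"
proof -
  have "odd m" using m(2) by presburger
  then have m0: "m > 0" by (auto intro: Nat.gr0I)
  have pf: "prime p \<and> 2 < p" if "p \<in> prime_factors m" for p
  proof -
    have "prime p" "p dvd m" using that by auto
    moreover from this \<open>odd m\<close> have "p \<noteq> 2" by auto
    ultimately show ?thesis using prime_ge_2_nat[of p] by simp
  qed
  obtain q :: nat where q: "q = 1 \<or> prime q" "q mod 4 = 1"
    and sym: "\<And>p. p \<in> prime_factors m \<Longrightarrow> Legendre (int q) (int p) = Legendre (-1) (int p)"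
    using exists_prime_with_residue_symbols[OF m(1) \<open>odd m\<close>] by auto
  have "QuadRes (int p) (- int q)" if p: "p \<in> prime_factors m" for p
  proof -
    have "Legendre (-1 * int q) p = Legendre (-1) p * Legendre (-1) p"
      using Legendre_mult[of p "-1" "int q"] pf[OF p] sym[OF p] by simp
    also have "\<dots> = 1" using Legendre_minus_one[of p] pf[OF p] by auto
    finally show ?thesis unfolding Legendre_def by (auto split: if_splits)
  qed
  then obtain h where h: "int m dvd h\<^sup>2 + int q" using exists_square_root_mod[OF m(1) m0, of "- int q"] by auto
  from q(1) show ?thesis
  proof
    assume "q = 1"
    then obtain r where "1 + h\<^sup>2 = int m * r" using h by (auto simp: add.commute elim: dvdE)
    then obtain a b where "int m = a\<^sup>2 + b\<^sup>2"
      using sum_two_squares_of_unimodular_form[of "int m" r h] m0 by auto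
    then show ?thesis by (intro exI[of _ a] exI[of _ b] exI[of _ 0]) simp
  next
    assume prime: "prime q"
    then have q2: "2 < q" using q(2) prime_ge_2_nat[of q] by (cases "q = 2") auto
    \<comment> \<open>If \<open>q\<close> divided \<open>m\<close>, its prescribed symbol
      \<open>Legendre q q = 0\<close> would have to equal \<open>Legendre (-1) q\<close>, which is
      nonzero.\<close>
    have cop: "coprime m q"
    proof (rule ccontr)
      assume "\<not> coprime m q"
      then have "q dvd m" using prime prime_imp_coprime coprime_commute by blast
      then have "q \<in> prime_factors m" using prime m0 by (auto simp: in_prime_factors_iff)
      then have "Legendre q q \<noteq> 0" using sym Legendre_minus_one[OF prime q2] by auto
      then show False by (simp add: Legendre_def cong_0_iff)
    qed
    \<comment> \<open>Since \<open>q\<close> is 1 modulo 4, reciprocity flips each symbol without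
      sign, and the prescribed values multiply to \<open>chi4 m = 1\<close>.\<close>
    have "Legendre (int m) q = (\<Prod>p\<in>prime_factors m. Legendre (int p) q)"
      using Legendre_prod[OF prime q2, of int "prime_factors m"] squarefree_eq_prod_prime_factors[OF m(1) m0]
      by (simp flip: of_nat_prod)
    also have "\<dots> = (\<Prod>p\<in>prime_factors m. chi4 p)"
    proof (rule prod.cong)
      fix p assume p: "p \<in> prime_factors m"
      have "p \<noteq> q" using p cop prime by (auto simp: in_prime_factors_iff)
      have "even ((q - 1) div 2)" using q(2) by presburger
      then have "Legendre p q * Legendre q p = 1"
        using Quadratic_Reciprocity[of p q] pf[OF p] prime q2 \<open>p \<noteq> q\<close> by simp
      then have "Legendre p q = Legendre q p"
        using Legendre_range[of p q] Legendre_range[of q p] by auto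
      also have "\<dots> = chi4 p"
      proof -
        have "odd p" using pf[OF p] by (simp add: prime_odd_nat)
        then have "p mod 4 = 1 \<or> p mod 4 = 3" by presburger
        then show ?thesis using sym[OF p] Legendre_minus_one[of p] pf[OF p] unfolding chi4_def by auto
      qed
      finally show "Legendre p q = chi4 p" .
    qed simp
    also have "\<dots> = chi4 m"
      using squarefree_eq_prod_prime_factors[OF m(1) m0] chi4_prod[of "\<lambda>p. p" "prime_factors m"] by simp
    also have "\<dots> = 1" unfolding chi4_def using m(2) by simp
    finally have "QuadRes q m" unfolding Legendre_def by (auto split: if_splits)
    then obtain g where g: "int q dvd g\<^sup>2 - int m" unfolding QuadRes_def by (auto simp: cong_iff_dvd_diff)
    obtain x y z where xyz: "y > 0" "int m * y\<^sup>2 = x\<^sup>2 + int q * z\<^sup>2"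
      using ternary_form_isotropic[OF m0 prime cop h g] .
    obtain u v where uv: "int q = u\<^sup>2 + v\<^sup>2" using sum_two_squares_prime[OF prime q(2)] by blast
    have "int m * y\<^sup>2 = x\<^sup>2 + (u * z)\<^sup>2 + (v * z)\<^sup>2"
      unfolding xyz(2) uv by (simp add: algebra_simps power2_eq_square)
    then show ?thesis using sum_three_squares_of_rational xyz(1) by blast
  qed
qed

text \<open>An odd square is 1 modulo 4, so dividing out the square part keeps the residue and
  leaves the squarefree case; scaling by \<open>s\<close> restores \<open>n\<close>.\<close>

theorem sum_three_squares_mod_4_eq_1:
  fixes n :: nat
  assumes "n mod 4 = 1"
  shows "\<exists>u v w. int n = u\<^sup>2 + v\<^sup>2 + w\<^sup>2"
proof -
  define s where "s = square_part n"
  have n: "n = squarefree_part n * s\<^sup>2" unfolding s_def by (rule squarefree_decompose)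
  have "odd n" using assms by presburger
  then have "odd s" using n by (metis even_mult_iff even_power pos2)
  then obtain k where "s = 2 * k + 1" by (elim oddE)
  then have "s\<^sup>2 = 4 * (k\<^sup>2 + k) + 1" by (simp add: algebra_simps power2_eq_square)
  then have "s\<^sup>2 mod 4 = 1" by presburger
  then have "squarefree_part n mod 4 = 1" using assms n by (metis mod_mult_right_eq mult.right_neutral)
  then obtain u v w where "int (squarefree_part n) = u\<^sup>2 + v\<^sup>2 + w\<^sup>2"
    using sum_three_squares_of_squarefree[of "squarefree_part n"] by auto
  then have "int n = (u * int s)\<^sup>2 + (v * int s)\<^sup>2 + (w * int s)\<^sup>2"
    by (subst n) (simp add: algebra_simps power_mult_distrib)
  then show ?thesis by blast
qed

section \<open>Norms of matrices\<close>

text \<open>The diagonal entries are \<open>p = (n + u) / 2\<close> and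
  \<open>r = (n - u) / 2\<close>: their sum is \<open>n\<close>, and
  \<open>4 * p * r = n^2 - u^2\<close> gives determinant 1 with off-diagonal entry
  \<open>x + i y\<close>.\<close>

lemma odd_mem_S_set:
  fixes n u v w :: int
  assumes "odd n" "n \<ge> 3" "n\<^sup>2 - 4 = u\<^sup>2 + v\<^sup>2 + w\<^sup>2" "odd u" "even v" "even w"
  shows "n \<in> S_set"
proof -
  obtain x y where vw: "v = 2 * x" "w = 2 * y" using assms(5,6) by (elim evenE)
  have "even (n + u)" "even (n - u)" using assms(1,4) by auto
  then obtain p r where pr: "n + u = 2 * p" "n - u = 2 * r" by (elim evenE)
  have n: "n = p + r" and u: "u = p - r" using pr by auto
  have "4 * (p * r) = 4 * (1 + x\<^sup>2 + y\<^sup>2)"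
    using assms(3) unfolding n u vw by (simp add: algebra_simps power2_eq_square)
  then have pr1: "p * r = 1 + x\<^sup>2 + y\<^sup>2" by simp
  have "0 < p * r" unfolding pr1 using zero_le_power2[of x] zero_le_power2[of y] by linarith
  moreover have "0 < p + r" using n assms(2) by simp
  ultimately have "p > 0" by (auto simp: zero_less_mult_iff)
  from unimodular_hermitian_form_factorization[OF this pr1] obtain a1 a2 b1 b2 c1 c2 d1 d2 :: int where
    f: "p = a1\<^sup>2 + a2\<^sup>2 + b1\<^sup>2 + b2\<^sup>2" "r = c1\<^sup>2 + c2\<^sup>2 + d1\<^sup>2 + d2\<^sup>2"
    "(a1 * d1 - a2 * d2) - (b1 * c1 - b2 * c2) = 1"
    "(a1 * d2 + a2 * d1) - (b1 * c2 + b2 * c1) = 0" by blast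
  let ?z = "\<lambda>s t :: int. Complex (of_int s) (of_int t)"
  define g :: "complex^2^2" where
    "g = vector [vector [?z a1 a2, ?z b1 b2], vector [?z c1 c2, ?z d1 d2]]"
  have "det g = ?z ((a1 * d1 - a2 * d2) - (b1 * c1 - b2 * c2)) ((a1 * d2 + a2 * d1) - (b1 * c2 + b2 * c1))"
    unfolding det_2 g_def by (simp add: complex_eq_iff)
  then have "det g = 1" unfolding f(3,4) by (simp add: complex_eq_iff)
  moreover have "\<forall>i j. gaussian_int (g $ i $ j)"
    unfolding g_def forall_2 gaussian_int_def by simp
  ultimately have "g \<in> SL2_Zi" unfolding SL2_Zi_def by simp
  moreover have "real_of_int n = normsq g"
    unfolding normsq_def sum_2 g_def n f(1,2) by (simp add: cmod_power2)
  ultimately show ?thesis unfolding S_set_def using assms(2) by auto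
qed

lemma two_mem_S_set: "2 \<in> S_set"
proof -
  have "mat 1 \<in> SL2_Zi" unfolding SL2_Zi_def by (simp add: gaussian_int_def mat_def det_2)
  moreover have "real_of_int 2 = normsq (mat 1)" unfolding normsq_def sum_2 by (simp add: mat_def)
  ultimately show ?thesis unfolding S_set_def by auto
qed

lemma odd_ge_3_mem_S_set:
  fixes n :: int
  assumes "odd n" "n \<ge> 3"
  shows "n \<in> S_set"
proof -
  have sq: "x\<^sup>2 mod 4 = (if even x then 0 else 1)" for x :: int
  proof (cases "even x")
    case True
    then obtain k where "x = 2 * k" by (elim evenE)
    then show ?thesis by (simp add: power_mult_distrib)
  next
    case False
    then obtain k where "x = 2 * k + 1" by (elim oddE)
    then have "x\<^sup>2 = 4 * (k\<^sup>2 + k) + 1" by (simp add: algebra_simps power2_eq_square)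
    moreover have "(4 * (k\<^sup>2 + k) + 1) mod 4 = 1" by presburger
    ultimately show ?thesis using False by simp
  qed
  have "3 * 3 \<le> n * n" using assms(2) by (intro mult_mono) auto
  then have N: "int (nat (n\<^sup>2 - 4)) = n\<^sup>2 - 4" by (simp add: power2_eq_square)
  have "(n\<^sup>2 - 4) mod 4 = 1" using sq[of n] assms(1) by (simp add: mod_diff_eq[symmetric])
  then have "int (nat (n\<^sup>2 - 4) mod 4) = int 1" unfolding zmod_int N by simp
  then have "nat (n\<^sup>2 - 4) mod 4 = 1" by (simp only: of_nat_eq_iff)
  then obtain u v w where uvw: "n\<^sup>2 - 4 = u\<^sup>2 + v\<^sup>2 + w\<^sup>2"
    using sum_three_squares_mod_4_eq_1[of "nat (n\<^sup>2 - 4)"] unfolding N by blast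
  have "(u\<^sup>2 + v\<^sup>2 + w\<^sup>2) mod 4 = 1" using \<open>(n\<^sup>2 - 4) mod 4 = 1\<close> uvw by simp
  moreover have "(a + b + c) mod 4 = (a mod 4 + b mod 4 + c mod 4) mod 4" for a b c :: int
    by (intro mod_add_cong) simp_all
  ultimately have "(u\<^sup>2 mod 4 + v\<^sup>2 mod 4 + w\<^sup>2 mod 4) mod 4 = 1" by (simp only:)
  \<comment> \<open>Squares are 0 or 1 modulo 4, so a sum of three that is 1 modulo 4 has exactly
    one odd term; permuting puts it first.\<close>
  then have "odd u \<and> even v \<and> even w \<or> odd v \<and> even u \<and> even w \<or> odd w \<and> even u \<and> even v"
    unfolding sq by (cases "even u"; cases "even v"; cases "even w") simp_all
  then consider "odd u" "even v" "even w" | "odd v" "even u" "even w" | "odd w" "even u" "even v"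
    by blast
  then show ?thesis
  proof cases
    case 1 then show ?thesis using odd_mem_S_set[OF assms uvw] by blast
  next
    case 2 then show ?thesis using odd_mem_S_set[of n v u w] assms uvw by simp
  next
    case 3 then show ?thesis using odd_mem_S_set[of n w u v] assms uvw by simp
  qed
qed

theorem theorem1p1:
  shows "(\<forall>n::int. odd n \<and> n \<ge> 3 \<longrightarrow> n \<in> S_set) \<and> (\<forall>p::int. prime p \<longrightarrow> p \<in> S_set)"
proof (intro conjI allI impI)
  fix p :: int assume p: "prime p"
  show "p \<in> S_set"
  proof (cases "p = 2")
    case True
    then show ?thesis using two_mem_S_set by simp
  next
    case False
    then have "2 < p" using p prime_ge_2_int[of p] by simp
    then show ?thesis using p prime_odd_int[of p] odd_ge_3_mem_S_set[of p] by simp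
  qed
qed (use odd_ge_3_mem_S_set in blast)

end
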